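(* Let $\mu,\nu$ be compactly supported probability measures on $\mathbb{R}$ such that $\mu$ is non-degenerate. Define $$F_{\mu,\nu}(h)=R_\mu(-G_\nu(h))+h\quad\text{for}\quad h\in\operatorname{dom}(F_{\mu,\nu})=\{h\in(-\infty,\operatorname{supp}_-\nu):G_\nu(h)\in-D_\mu\},$$ $$\mathcal{H}_{\mu,\nu}=\{h\in\operatorname{dom}(F_{\mu,\nu}):F_{\mu,\nu}'(t)>0\text{ for all }t\in(-\infty,h)\},\qquad h^*_{\mu,\nu}=\sup\mathcal{H}_{\mu,\nu}.$$ Then: (a) $\operatorname{dom}(F_{\mu,\nu})$ is an interval of the form $(-\infty,h_{\max})$. (b) $F_{\mu,\nu}$ is increasing for small enough $h$ (i.e. on $(-\infty,h_0)$ for some $h_0$). (c) $g^*_{\mu\boxplus\nu}=G_\nu(h^*_{\mu,\nu})$. (d) $z^*_{\mu\boxplus\nu}=F_{\mu,\nu}(h^*_{\mu,\nu})=\sup_{h\in\mathcal{H}_{\mu,\nu}}F_{\mu,\nu}(h)$, where if $h^*_{\mu,\nu}\notin\operatorname{dom}(F_{\mu,\nu})$ then $F_{\mu,\nu}(h^*_{\mu,\nu})$ denotes the limit $\lim_{h\uparrow h^*_{\mu,\nu}}F_{\mu,\nu}(h)$, which exists. (e) $G_\nu(h^*_{\mu,\nu})$ lies in the closure of $-\hat D_\mu$. (f) Statements (a), (b), (c), (d) and (e) all remain true if $D_\mu$ in the definition of $\operatorname{dom}(F_{\mu,\nu})$ is replaced by the possibly smaller interval $\hat D_\mu$ (with $\mathcal{H}_{\mu,\nu}$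 and $h^*_{\mu,\nu}$ then defined using this smaller domain).
   Context: For a compactly supported probability measure $\rho$ on $\mathbb{R}$: $\operatorname{supp}_-\rho$ and $\operatorname{supp}_+\rho$ are the infimum and supremum of its support; $\rho$ is non-degenerate if it is not a Dirac mass. $G_\rho(z)=\int\frac{\rho(d\lambda)}{\lambda-z}$ (note the sign). On the real line, $G_\rho$ is strictly increasing and positive on $(-\infty,\operatorname{supp}_-\rho)$, strictly increasing and negative on $(\operatorname{supp}_+\rho,\infty)$; set $G_\rho(\operatorname{supp}_-\rho)=\lim_{z\uparrow\operatorname{supp}_-\rho}G_\rho(z)\in(0,\infty]$ and $G_\rho(\operatorname{supp}_+\rho)=\lim_{z\downarrow\operatorname{supp}_+\rho}G_\rho(z)\in[-\infty,0)$. $G_\rho^{\langle-1\rangle}$ is the inverse of $G_\rho$ restricted to $\mathbb{R}\setminus[\operatorname{supp}_-\rho,\operatorname{supp}_+\rho]$. Let $\hat D_\rho=(-G_\rho(\operatorname{supp}_-\rho),-G_\rho(\operatorname{supp}_+\rho))$, and $\hat R_\rho(t)=G_\rho^{\langle-1\rangle}(-t)-t^{-1}$ for $t\in\hat D_\rho\setminus\{0\}$. The real $R$-transform $R_\rho:D_\rho\to\mathbb{R}$ is the unique real analytic extension of $\hat R_\rho$ to a maximal open interval $D_\rho\supset\hat D_\rho$ (so $0\in D_\rho$). The free additive convolution $\mu\boxplus\nu$ is the unique compactly supported probability measure with $D_\mu\cap D_\nu\subset D_{\mu\boxplus\nu}$ and $R_{\mu\boxplus\nu}=R_\mu+R_\nu$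 on $D_\mu\cap D_\nu$. $z^*_{\mu\boxplus\nu}=\operatorname{supp}_-(\mu\boxplus\nu)$ and $g^*_{\mu\boxplus\nu}=G_{\mu\boxplus\nu}(z^*_{\mu\boxplus\nu})\in(0,\infty]$. Closures are taken in the extended reals $[-\infty,\infty]$. *)

theory Defs
  imports "HOL-Probability.Probability"
begin

definition msupport :: "real measure \<Rightarrow> real set" where
  "msupport M = {x. \<forall>U. open U \<and> x \<in> U \<longrightarrow> emeasure M U > 0}"

definition compactly_supported :: "real measure \<Rightarrow> bool" where
  "compactly_supported M \<longleftrightarrow> real_distribution M \<and> compact (msupport M)"

definition nondegenerate :: "real measure \<Rightarrow> bool" where
  "nondegenerate M \<longleftrightarrow> (\<forall>a. M \<noteq> return borel a)"

definition supp_minus :: "real measure \<Rightarrow> real" where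
  "supp_minus M = Inf (msupport M)"

definition supp_plus :: "real measure \<Rightarrow> real" where
  "supp_plus M = Sup (msupport M)"

text \<open>The sign convention is opposite to the usual Cauchy transform. The integral is only
  meaningful for real \<open>z\<close> outside the interval from \<open>supp_minus M\<close> to \<open>supp_plus M\<close>; the boundary
  values are the separate extended-real constants \<open>G_minus\<close> and \<open>G_plus\<close> (they differ even when
  \<open>M\<close> is a Dirac mass and the two end points coincide).\<close>

definition G :: "real measure \<Rightarrow> real \<Rightarrow> real" where
  "G M z = (\<integral>x. 1 / (x - z) \<partial>M)"

definition G_minus :: "real measure \<Rightarrow> ereal" where
  "G_minus M = Lim (at_left (supp_minus M)) (\<lambda>z. ereal (G M z))"

definition G_plus :: "real measure \<Rightarrow> ereal" where
  "G_plus M = Lim (at_right (supp_plus M)) (\<lambda>z. ereal (G M z))"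

text \<open>\<open>G\<close> on the closed half-line up to and including \<open>supp_minus M\<close>.\<close>

definition G_left :: "real measure \<Rightarrow> real \<Rightarrow> ereal" where
  "G_left M z = (if z = supp_minus M then G_minus M else ereal (G M z))"

definition G_inv :: "real measure \<Rightarrow> real \<Rightarrow> real" where
  "G_inv M = the_inv_into (UNIV - {supp_minus M..supp_plus M}) (G M)"

definition D_hat :: "real measure \<Rightarrow> real set" where
  "D_hat M = {t. - G_minus M < ereal t \<and> ereal t < - G_plus M}"

definition R_hat :: "real measure \<Rightarrow> real \<Rightarrow> real" where
  "R_hat M t = G_inv M (- t) - 1 / t"

definition real_analytic_on :: "(real \<Rightarrow> real) \<Rightarrow> real set \<Rightarrow> bool" where
  "real_analytic_on f S \<longleftrightarrow> (\<forall>x\<in>S. \<exists>A. (\<lambda>t. f (x + t)) has_fps_expansion A)"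

definition R_extension :: "real measure \<Rightarrow> real set \<Rightarrow> (real \<Rightarrow> real) \<Rightarrow> bool" where
  "R_extension M I f \<longleftrightarrow> open I \<and> is_interval I \<and> D_hat M \<subseteq> I \<and> real_analytic_on f I \<and>
     (\<forall>t\<in>D_hat M - {0}. f t = R_hat M t)"

text \<open>By the identity theorem, analytic extensions to open intervals containing \<open>D_hat M\<close> agree
  wherever both are defined, so the union of all such intervals is the maximal one. The function
  \<open>R_transform M\<close> is determined on \<open>R_domain M\<close> only.\<close>

definition R_domain :: "real measure \<Rightarrow> real set" where
  "R_domain M = \<Union>{I. \<exists>f. R_extension M I f}"

definition R_transform :: "real measure \<Rightarrow> real \<Rightarrow> real" where
  "R_transform M = (SOME f. R_extension M (R_domain M) f)"

text \<open>\<open>K\<close> is the free additive convolution of \<open>M\<close> and \<open>N\<close>.\<close>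

definition is_free_convolution :: "real measure \<Rightarrow> real measure \<Rightarrow> real measure \<Rightarrow> bool" where
  "is_free_convolution M N K \<longleftrightarrow> compactly_supported K \<and>
     R_domain M \<inter> R_domain N \<subseteq> R_domain K \<and>
     (\<forall>t\<in>R_domain M \<inter> R_domain N. R_transform K t = R_transform M t + R_transform N t)"

text \<open>In the following, the set \<open>D\<close> is either \<open>R_domain M\<close> or \<open>D_hat M\<close>. The function \<open>F M N\<close> is
  total, but only its values on \<open>F_dom D N\<close> are meaningful.\<close>

definition F :: "real measure \<Rightarrow> real measure \<Rightarrow> real \<Rightarrow> real" where
  "F M N h = R_transform M (- G N h) + h"

definition F_dom :: "real set \<Rightarrow> real measure \<Rightarrow> real set" where
  "F_dom D N = {h. h < supp_minus N \<and> G N h \<in> uminus ` D}"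

definition H_set :: "real set \<Rightarrow> real measure \<Rightarrow> real measure \<Rightarrow> real set" where
  "H_set D M N =
     {h \<in> F_dom D N. \<forall>t<h. \<exists>d>0. (F M N has_real_derivative d) (at t)}"

definition h_star :: "real set \<Rightarrow> real measure \<Rightarrow> real measure \<Rightarrow> real" where
  "h_star D M N = Sup (H_set D M N)"

end

(* Parametrise by g = G_nu(h). Wherever all three inverses are defined, additivity of the R-transform says
   G_kappa^-1(g) = G_mu^-1(g) + G_nu^-1(g) + 1/g, so F(h) = G_kappa^-1(G_nu(h)) and F is strictly increasing there.

   The key point is g*_kappa <= min(G_mu(supp_-), G_nu(supp_-)). Suppose instead that, say, G_nu reaches its end value
   at G_kappa(L) with L < z*. On (-infinity, L) put h(z) = G_nu^-1(G_kappa(z)) and k(z) = G_mu^-1(G_kappa(z)). Then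
   h = z + a_mu(k) and k = z + a_nu(h), where a(u) = -u - 1/G(u). The Taylor coefficients of G_mu and G_nu left of the
   support are moment sequences, hence log-convex, and Kaluza's theorem together with the Cauchy-Schwarz inequality
   shows that those of a_mu and a_nu are non-negative from degree one on. By induction on the degree so are those of
   h and k, and h' >= 1. Comparing coefficients in G_nu(h(z)) = G_kappa(z), those of G_nu near supp_- nu are bounded by
   those of G_kappa left of L, so nu has no mass near supp_- nu.

   Hence F has positive derivative as long as G_nu(h) < g*_kappa and F(h) tends to z* where G_nu(h) reaches g*_kappa.
   If F could be continued there with positive derivative, G_nu composed with the local inverse of F would continue
   G_kappa analytically across z*, and the Cauchy estimates would leave kappa without mass near z*. *)

theory Submission
  imports Defs "HOL-Complex_Analysis.Complex_Analysis"
begin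

text \<open>Additivity of the R-transforms speaks only of values that all three transforms attain.
  Nothing in it forbids \<open>G K\<close> from growing past the end value of \<open>M\<close> or
  \<open>N\<close>, and excluding this is the real obstacle (\<open>M\<close>, \<open>N\<close>,
  \<open>K\<close> stand for mu, nu, kappa). Instead of subordination in the complex upper half
  plane, positivity on the real line is used: left of the support the Taylor coefficients of a
  Cauchy transform are positive, and their growth detects mass at the lower end point, in the spirit
  of Pringsheim's theorem. Comparing coefficients is therefore enough, and both contradictions of
  the proof end in \<open>cauchy_fps_radius_contradiction\<close>. The argument is run for the
  measure with the smaller end value, since \<open>h\<close> and \<open>k\<close> exist together
  only below it.

  Claim (f) comes at no extra cost: the candidate \<open>h_edge\<close> for the supremum is defined
  from \<open>N\<close> and \<open>K\<close> alone, and the facts about \<open>F\<close> are proved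
  for any open interval \<open>D\<close> between \<open>D_hat M\<close> and
  \<open>R_domain M\<close>. Claim (e) holds because left of \<open>h_edge\<close> the values of
  \<open>G N\<close> stay below the end value of \<open>M\<close>.\<close>

unbundle no vec_syntax

section \<open>Formal power series with non-negative coefficients\<close>

text \<open>Log-convexity makes the ratios \<open>r\<close> of consecutive coefficients increase.
  Multiplying the identity for degree \<open>Suc m\<close> by \<open>r (Suc m)\<close> and comparing
  it term by term with the one for degree \<open>Suc (Suc m)\<close> cancels the contributions of
  \<open>b 0\<close>; the error is one-sided because the other \<open>b k\<close> met so far are
  non-positive.\<close>

lemma Kaluza_inverse_nonpos:
  fixes A :: "real fps"
  assumes pos: "\<And>n. A $ n > 0" and lc: "\<And>n. (A $ Suc n)\<^sup>2 \<le> A $ n * A $ Suc (Suc n)"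
    and n: "n \<ge> 1"
  shows "inverse A $ n \<le> 0"
proof -
  define b where "b n = inverse A $ n" for n
  have A0: "A $ 0 \<noteq> 0" using pos[of 0] by simp
  have conv: "(\<Sum>i=0..n. A $ i * b (n - i)) = (if n = 0 then 1 else 0)" for n
  proof -
    have "(A * inverse A) $ n = (1::real fps) $ n"
      using A0 by (metis inverse_mult_eq_1')
    then show ?thesis by (simp add: fps_mult_nth b_def)
  qed
  have b0: "b 0 > 0" using pos[of 0] by (simp add: b_def)
  have rec: "A $ 0 * b (Suc m) = - A $ Suc m * b 0 - (\<Sum>k=1..m. A $ (Suc m - k) * b k)" for m
  proof -
    have "0 = (\<Sum>i=0..Suc m. A $ i * b (Suc m - i))" using conv[of "Suc m"] by simp
    also have "\<dots> = (\<Sum>k=0..Suc m. A $ (Suc m - k) * b k)"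
      by (subst sum.atLeastAtMost_rev) (auto intro!: sum.cong)
    also have "\<dots> = A $ 0 * b (Suc m) + (\<Sum>k=0..m. A $ (Suc m - k) * b k)" by simp
    also have "(\<Sum>k=0..m. A $ (Suc m - k) * b k)
        = A $ Suc m * b 0 + (\<Sum>k=1..m. A $ (Suc m - k) * b k)"
      by (subst sum.atLeast_Suc_atMost) auto
    finally show ?thesis by simp
  qed
  define r where "r n = A $ Suc n / A $ n" for n
  have r_pos: "r n > 0" for n using pos by (simp add: r_def)
  have "r n \<le> r (Suc n)" for n
    using lc[of n] pos[of n] pos[of "Suc n"]
    by (simp add: r_def field_simps power2_eq_square)
  then have r_mono: "m \<le> n \<Longrightarrow> r m \<le> r n" for m n by (rule lift_Suc_mono_le)
  have Ar: "A $ Suc n = r n * A $ n" for n using pos[of n] by (simp add: r_def)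
  have "b n \<le> 0" using n
  proof (induction n rule: less_induct)
    case (less n)
    show ?case
    proof (cases "n = 1")
      case True
      have "A $ 0 * b 1 = - A $ 1 * b 0" using rec[of 0] by simp
      also have "\<dots> \<le> 0" using b0 pos[of 1] by simp
      finally show ?thesis using True pos[of 0] by (simp add: mult_le_0_iff)
    next
      case False
      then obtain m where m: "n = Suc (Suc m)" using less.prems by (metis One_nat_def not_one_le_zero old.nat.exhaust)
      have "A $ 0 * b (Suc m) + A $ Suc m * b 0 + (\<Sum>k=1..m. A $ (Suc m - k) * b k) = 0"
        using rec[of m] by simp
      then have z: "A $ Suc m * b 0 = - (\<Sum>k=1..Suc m. A $ (Suc m - k) * b k)" by simp
      have "(\<Sum>k=1..Suc m. A $ (Suc (Suc m) - k) * b k) \<ge> (\<Sum>k=1..Suc m. r (Suc m) * (A $ (Suc m - k) * b k))"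
      proof (rule sum_mono)
        fix k assume k: "k \<in> {1..Suc m}"
        have "b k \<le> 0" using less.IH[of k] k m by auto
        moreover have "A $ (Suc (Suc m) - k) = r (Suc m - k) * A $ (Suc m - k)"
          using k Ar[of "Suc m - k"] by (simp add: Suc_diff_le)
        moreover have "r (Suc m - k) * A $ (Suc m - k) \<le> r (Suc m) * A $ (Suc m - k)"
          using pos[of "Suc m - k"] by (intro mult_right_mono r_mono) auto
        ultimately show "r (Suc m) * (A $ (Suc m - k) * b k) \<le> A $ (Suc (Suc m) - k) * b k"
          by (metis mult.assoc mult_right_mono_neg)
      qed
      also have "(\<Sum>k=1..Suc m. r (Suc m) * (A $ (Suc m - k) * b k)) = - r (Suc m) * (A $ Suc m * b 0)"
        unfolding z by (simp only: sum_distrib_left [symmetric] minus_mult_minus)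
      also have "\<dots> = - A $ Suc (Suc m) * b 0" by (simp add: Ar[of "Suc m"])
      finally have "A $ 0 * b (Suc (Suc m)) \<le> 0" using rec[of "Suc m"] by simp
      then show ?thesis using pos[of 0] m by (simp add: mult_le_0_iff)
    qed
  qed
  then show ?thesis by (simp add: b_def)
qed

lemma fps_power_nth_nonneg:
  fixes H :: "'a :: linordered_idom fps"
  assumes "\<And>j. j \<le> n \<Longrightarrow> H $ j \<ge> 0"
  shows "(H ^ i) $ n \<ge> 0"
  using assms
proof (induction i arbitrary: n)
  case 0 then show ?case by simp
next
  case (Suc i)
  then show ?case by (auto simp: fps_mult_nth intro!: sum_nonneg mult_nonneg_nonneg)
qed

text \<open>With zero constant term and at least two factors, no factor can carry the full degree
  \<open>n\<close>, so the sign of \<open>H $ n\<close> is irrelevant. This isolates the linear part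
  in the induction on the degree for the coupled equations.\<close>

lemma fps_power_nth_nonneg_lower:
  fixes H :: "'a :: linordered_idom fps"
  assumes "H $ 0 = 0" "\<And>j. j < n \<Longrightarrow> H $ j \<ge> 0" "i \<ge> 2"
  shows "(H ^ i) $ n \<ge> 0"
proof (cases n)
  case 0
  then show ?thesis using assms by (simp add: fps_nth_power_0)
next
  case (Suc m)
  \<comment> \<open>Splitting off one \<open>fps_X\<close> leaves a product of degree
    \<open>m\<close>; its only term containing \<open>H $ n\<close> is the one for
    \<open>l = 0\<close>, whose other factor vanishes.\<close>
  define H' where "H' = fps_shift 1 H"
  have H: "H = H' * fps_X"
    unfolding H'_def using assms(1) by (intro fps_ext) (auto simp: fps_mult_fps_X_commute)
  obtain j where j: "i = Suc j" "j \<ge> 1" using assms(3) by (cases i) auto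
  have "(H ^ i) $ n = (H ^ j * H') $ m"
    unfolding j Suc power_Suc2 by (subst (2) H) (simp add: mult.assoc[symmetric] fps_mult_fps_X_commute)
  also have "\<dots> \<ge> 0"
    unfolding fps_mult_nth
  proof (intro sum_nonneg)
    fix l assume l: "l \<in> {0..m}"
    show "(H ^ j) $ l * H' $ (m - l) \<ge> 0"
    proof (cases "l = 0")
      case True then show ?thesis using j assms(1) by (simp add: fps_nth_power_0 power_0_left)
    next
      case False
      have "(H ^ j) $ l \<ge> 0" using l Suc assms(2) by (intro fps_power_nth_nonneg) auto
      moreover have "H' $ (m - l) \<ge> 0" using l False Suc assms(2) by (auto simp: H'_def)
      ultimately show ?thesis by simp
    qed
  qed
  finally show ?thesis .
qed

lemma fps_compose_nth_split:
  fixes A B :: "'a :: comm_ring_1 fps"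
  assumes "n \<ge> 1" "B $ 0 = 0"
  shows "(A oo B) $ n = A $ 1 * B $ n + (\<Sum>i=2..n. A $ i * (B ^ i) $ n)"
proof -
  have "(A oo B) $ n = (\<Sum>i=0..n. A $ i * (B ^ i) $ n)" by (simp add: fps_compose_nth)
  also have "\<dots> = A $ 0 * (B ^ 0) $ n + (\<Sum>i=1..n. A $ i * (B ^ i) $ n)"
    by (subst sum.atLeast_Suc_atMost) auto
  also have "(\<Sum>i=1..n. A $ i * (B ^ i) $ n) = A $ 1 * B $ n + (\<Sum>i=2..n. A $ i * (B ^ i) $ n)"
    using assms(1) by (subst sum.atLeast_Suc_atMost) (auto simp: numeral_2_eq_2)
  finally show ?thesis using assms by simp
qed

text \<open>In degree \<open>n\<close> the two equations are linear in \<open>H $ n\<close> and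
  \<open>K $ n\<close>, with remainders \<open>P\<close> and \<open>Q\<close> that involve lower
  degrees only. The determinant \<open>1 - A $ 1 * B $ 1\<close> is positive because the equations
  of degree one have a solution with \<open>H $ 1 > 0\<close>.\<close>

lemma coupled_fps_nonneg:
  fixes H K A B :: "real fps"
  assumes "H $ 0 = 0" "K $ 0 = 0" and "H $ 1 > 0" "K $ 1 > 0"
    and A: "\<And>n. n \<ge> 1 \<Longrightarrow> A $ n \<ge> 0" and B: "\<And>n. n \<ge> 1 \<Longrightarrow> B $ n \<ge> 0"
    and HK: "\<And>n. n \<ge> 1 \<Longrightarrow> H $ n = fps_X $ n + (A oo K) $ n"
    and KH: "\<And>n. n \<ge> 1 \<Longrightarrow> K $ n = fps_X $ n + (B oo H) $ n"
  shows "H $ n \<ge> 0 \<and> K $ n \<ge> 0"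
proof (induction n rule: less_induct)
  case (less n)
  have H1: "H $ 1 = 1 + A $ 1 * K $ 1" and K1: "K $ 1 = 1 + B $ 1 * H $ 1"
    using HK[of 1] KH[of 1] assms(1,2) by (simp_all add: fps_compose_nth_split)
  have "H $ 1 * (1 - A $ 1 * B $ 1) = 1 + A $ 1"
    using H1 unfolding K1 by (simp add: algebra_simps)
  then have "H $ 1 * (1 - A $ 1 * B $ 1) > 0" using A[of 1] by simp
  then have AB: "1 - A $ 1 * B $ 1 > 0" using assms(3) by (simp add: zero_less_mult_iff)
  show ?case
  proof (cases "n \<le> 1")
    case True
    then have "n = 0 \<or> n = 1" by auto
    then show ?thesis using assms(1-4) by auto
  next
    case False
    define P Q where "P = (\<Sum>i=2..n. A $ i * (K ^ i) $ n)" and "Q = (\<Sum>i=2..n. B $ i * (H ^ i) $ n)"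
    have P: "P \<ge> 0" unfolding P_def
      using less assms(2) A by (intro sum_nonneg mult_nonneg_nonneg fps_power_nth_nonneg_lower) auto
    have Q: "Q \<ge> 0" unfolding Q_def
      using less assms(1) B by (intro sum_nonneg mult_nonneg_nonneg fps_power_nth_nonneg_lower) auto
    have Hn: "H $ n = A $ 1 * K $ n + P" and Kn: "K $ n = B $ 1 * H $ n + Q"
      using HK[of n] KH[of n] False assms(1,2) by (simp_all add: fps_compose_nth_split P_def Q_def)
    have "H $ n * (1 - A $ 1 * B $ 1) = A $ 1 * Q + P"
      using Hn unfolding Kn by (simp add: algebra_simps)
    also have "\<dots> \<ge> 0" using A[of 1] P Q by simp
    finally have "H $ n \<ge> 0" using AB by (simp add: zero_le_mult_iff)
    then show ?thesis using Kn B[of 1] Q by simp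
  qed
qed

text \<open>Of the non-negative terms of the composition only the one for \<open>i = n\<close> is
  kept.\<close>

lemma fps_compose_nth_ge:
  fixes A H :: "'a :: linordered_idom fps"
  assumes "\<And>n. A $ n \<ge> 0" "\<And>n. H $ n \<ge> 0" "H $ 0 = 0"
  shows "(A oo H) $ n \<ge> A $ n * (H $ 1) ^ n"
proof -
  have "A $ n * (H $ 1) ^ n = (\<Sum>i\<in>{n}. A $ i * (H ^ i) $ n)"
    using assms(3) by (simp add: startsby_zero_power_nth_same)
  also have "\<dots> \<le> (\<Sum>i=0..n. A $ i * (H ^ i) $ n)"
    using assms by (intro sum_mono2 mult_nonneg_nonneg fps_power_nth_nonneg) auto
  finally show ?thesis by (simp add: fps_compose_nth)
qed

section \<open>Real-analytic functions\<close>

text \<open>Complex analysis (composition, local inverses, Cauchy estimates) is applied to the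
  complexified series, and \<open>Re_fps\<close> brings the results back to the real line.\<close>

definition complex_fps :: "real fps \<Rightarrow> complex fps" where
  "complex_fps A = Abs_fps (\<lambda>n. of_real (A $ n))"

definition Re_fps :: "complex fps \<Rightarrow> real fps" where
  "Re_fps C = Abs_fps (\<lambda>n. Re (C $ n))"

lemma complex_fps_nth [simp]: "complex_fps A $ n = of_real (A $ n)"
  by (simp add: complex_fps_def)

lemma Re_fps_nth [simp]: "Re_fps C $ n = Re (C $ n)"
  by (simp add: Re_fps_def)

lemma Re_fps_complex_fps [simp]: "Re_fps (complex_fps A) = A"
  by (simp add: fps_eq_iff)

lemma complex_fps_mult: "complex_fps (A * B) = complex_fps A * complex_fps B"
  by (simp add: fps_eq_iff fps_mult_nth)

lemma complex_fps_power: "complex_fps (A ^ n) = complex_fps A ^ n"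
  by (induction n) (simp_all add: complex_fps_mult, simp add: fps_eq_iff)

lemma complex_fps_compose: "complex_fps (A oo B) = complex_fps A oo complex_fps B"
  by (simp add: fps_eq_iff fps_compose_nth complex_fps_power [symmetric])

lemma fps_conv_radius_complex_fps [simp]: "fps_conv_radius (complex_fps A) = fps_conv_radius A"
proof -
  have "fps_conv_radius (complex_fps A) = conv_radius (\<lambda>n. norm (complex_fps A $ n))"
    unfolding fps_conv_radius_def by (rule conv_radius_norm [symmetric])
  also have "\<dots> = conv_radius (\<lambda>n. norm (A $ n))" by simp
  also have "\<dots> = fps_conv_radius A" unfolding fps_conv_radius_def by (rule conv_radius_norm)
  finally show ?thesis .
qed

lemma fps_conv_radius_Re_fps: "fps_conv_radius C \<le> fps_conv_radius (Re_fps C)"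
  unfolding fps_conv_radius_def
proof (rule conv_radius_geI_ex)
  fix r :: real assume r: "0 < r" "ereal r < conv_radius (fps_nth C)"
  have "summable (\<lambda>n. norm (C $ n * of_real r ^ n))"
    using r by (intro abs_summable_in_conv_radius) simp
  then have "summable (\<lambda>n. Re_fps C $ n * of_real r ^ n)"
    by (rule summable_comparison_test [rotated])
      (use r in \<open>auto simp: norm_mult norm_power abs_mult intro!: mult_right_mono abs_Re_le_cmod\<close>)
  then show "\<exists>z. norm z = r \<and> summable (\<lambda>n. Re_fps C $ n * z ^ n)"
    using r by (intro exI[of _ r]) simp
qed

lemma eval_complex_fps_of_real:
  assumes "ereal \<bar>t\<bar> < fps_conv_radius A"
  shows "eval_fps (complex_fps A) (of_real t) = of_real (eval_fps A t)"
proof -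
  have "(\<lambda>n. A $ n * t ^ n) sums eval_fps A t"
    using assms by (intro sums_eval_fps) auto
  then have "(\<lambda>n. complex_of_real (A $ n * t ^ n)) sums of_real (eval_fps A t)"
    by (rule sums_of_real)
  then show ?thesis by (simp add: eval_fps_def sums_iff)
qed

lemma eventually_nhds_0_ereal_less:
  assumes "r > 0"
  shows "eventually (\<lambda>t::real. ereal \<bar>t\<bar> < r) (nhds 0)"
proof -
  have "eventually (\<lambda>t::real. t \<in> eball 0 r) (nhds 0)"
    using assms by (intro eventually_nhds_in_open) (auto simp: zero_ereal_def)
  then show ?thesis by (auto elim!: eventually_mono simp: in_eball_iff)
qed

lemma eventually_nhds_0_of_real:
  assumes "eventually P (nhds (0::complex))"
  shows "eventually (\<lambda>t::real. P (of_real t)) (nhds 0)"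
proof -
  have "((\<lambda>t::real. complex_of_real t) \<longlongrightarrow> of_real 0) (nhds 0)"
    by (intro tendsto_of_real filterlim_ident)
  then show ?thesis using assms unfolding filterlim_def le_filter_def eventually_filtermap by auto
qed

lemma has_fps_expansion_complexify:
  assumes "f has_fps_expansion A"
  shows "eval_fps (complex_fps A) has_fps_expansion complex_fps A"
    and "eventually (\<lambda>t. eval_fps (complex_fps A) (of_real t) = of_real (f t)) (nhds 0)"
proof -
  have pos: "fps_conv_radius A > 0" and ev: "eventually (\<lambda>z. eval_fps A z = f z) (nhds 0)"
    using assms by (auto simp: has_fps_expansion_def)
  show "eval_fps (complex_fps A) has_fps_expansion complex_fps A"
    using pos by (intro eval_fps_has_fps_expansion) simp
  show "eventually (\<lambda>t. eval_fps (complex_fps A) (of_real t) = of_real (f t)) (nhds 0)"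
    using ev eventually_nhds_0_ereal_less [OF pos]
    by eventually_elim (simp add: eval_complex_fps_of_real)
qed

lemma has_fps_expansion_Re:
  assumes "g has_fps_expansion C"
  shows "(\<lambda>t. Re (g (of_real t))) has_fps_expansion Re_fps C"
proof -
  have pos: "fps_conv_radius C > 0" and ev: "eventually (\<lambda>z. eval_fps C z = g z) (nhds 0)"
    using assms by (auto simp: has_fps_expansion_def)
  have *: "eval_fps (Re_fps C) t = Re (eval_fps C (of_real t))"
    if "ereal \<bar>t\<bar> < fps_conv_radius C" for t
  proof -
    have "(\<lambda>n. C $ n * of_real t ^ n) sums eval_fps C (of_real t)"
      using that by (intro sums_eval_fps) auto
    then have "(\<lambda>n. Re (C $ n * of_real t ^ n)) sums Re (eval_fps C (of_real t))"
      by (rule sums_Re)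
    then have "(\<lambda>n. Re (C $ n) * t ^ n) sums Re (eval_fps C (of_real t))"
      by (simp flip: of_real_power)
    then show ?thesis by (simp add: eval_fps_def sums_iff)
  qed
  have "eventually (\<lambda>t. eval_fps (Re_fps C) t = Re (g (of_real t))) (nhds 0)"
    using eventually_nhds_0_of_real [OF ev] eventually_nhds_0_ereal_less [OF pos]
    by eventually_elim (simp add: *)
  then show ?thesis
    using pos fps_conv_radius_Re_fps [of C] by (auto simp: has_fps_expansion_def)
qed

section \<open>Expansions at a point: uniqueness, composition, Cauchy estimates, inversion\<close>

lemma has_fps_expansion_transfer:
  assumes "eventually (\<lambda>t. f t = g t) (nhds 0)" "f has_fps_expansion A"
  shows "g has_fps_expansion A"
  using assms by (auto simp: has_fps_expansion_def elim: eventually_elim2)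

lemma has_fps_expansion_nth_0:
  assumes "f has_fps_expansion A"
  shows "A $ 0 = f 0"
  using assms by (auto simp: has_fps_expansion_def eval_fps_at_0 dest: eventually_nhds_x_imp_x)

text \<open>Isolated zeros. This gives both the uniqueness of expansions and the identity theorem
  for extensions of the R-transform.\<close>

lemma has_fps_expansion_eventually_nonzero:
  fixes A :: "'a :: {banach, real_normed_field} fps"
  assumes f: "f has_fps_expansion A" and "A \<noteq> 0"
  shows "eventually (\<lambda>t. f t \<noteq> 0) (at 0)"
proof (cases "f 0 = 0")
  case True
  have pos: "fps_conv_radius A > 0" and ev: "eventually (\<lambda>z. eval_fps A z = f z) (nhds 0)"
    using f by (auto simp: has_fps_expansion_def)
  obtain r where r: "r > 0" "ereal r < fps_conv_radius A"
    using pos ereal_dense2 by (metis ereal_less(2) zero_ereal_def)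
  obtain m where m: "A $ m \<noteq> 0" using \<open>A \<noteq> 0\<close> by (auto simp: fps_eq_iff)
  have "A $ 0 = 0" using True has_fps_expansion_nth_0 [OF f] by simp
  then have "m > 0" using m by (cases m) auto
  have sums: "(\<lambda>n. A $ n * (x - 0) ^ n) sums eval_fps A x" if "norm (x - 0) < r" for x
    using that r sums_eval_fps [of x A] by (auto intro: less_trans simp: less_ereal.simps(1) [symmetric] simp del: less_ereal.simps(1))
  obtain s where s: "0 < s" "\<And>z. z \<in> cball 0 s - {0} \<Longrightarrow> eval_fps A z \<noteq> 0"
    by (rule powser_0_nonzero [OF r(1) sums _ m \<open>m > 0\<close>]) (use \<open>A $ 0 = 0\<close> in \<open>auto simp: eval_fps_at_0\<close>)
  have "eventually (\<lambda>z. z \<in> ball 0 s - {0}) (at (0::'a))"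
    using s(1) by (auto simp: eventually_at intro!: exI[of _ s])
  then have "eventually (\<lambda>z. eval_fps A z \<noteq> 0) (at 0)"
    by eventually_elim (use s(2) in auto)
  moreover have "eventually (\<lambda>z. eval_fps A z = f z) (at 0)"
    using ev by (auto simp: eventually_at_filter elim: eventually_mono)
  ultimately show ?thesis by eventually_elim simp
next
  case False
  have "isCont f 0" using has_fps_expansion_imp_continuous [OF f, of UNIV] by simp
  then show ?thesis using False by (simp add: continuous_at tendsto_imp_eventually_ne)
qed

lemma has_fps_expansion_unique:
  fixes A B :: "'a :: {banach, real_normed_field} fps"
  assumes "f has_fps_expansion A" "f has_fps_expansion B"
  shows "A = B"
proof (rule ccontr)
  assume "A \<noteq> B"
  then have "A - B \<noteq> 0" by simp
  moreover have "(\<lambda>t. f t - f t) has_fps_expansion A - B"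
    by (intro has_fps_expansion_diff assms)
  ultimately have "eventually (\<lambda>t::'a. f t - f t \<noteq> 0) (at 0)"
    by (intro has_fps_expansion_eventually_nonzero)
  then show False by simp
qed

lemma has_fps_expansion_compose_real:
  fixes f g :: "real \<Rightarrow> real"
  assumes f: "f has_fps_expansion A" and g: "g has_fps_expansion B" and B0: "B $ 0 = 0"
  shows "(\<lambda>t. f (g t)) has_fps_expansion (A oo B)"
proof -
  let ?f = "eval_fps (complex_fps A)" and ?g = "eval_fps (complex_fps B)"
  have "(?f \<circ> ?g) has_fps_expansion (complex_fps A oo complex_fps B)"
    by (intro has_fps_expansion_compose has_fps_expansion_complexify(1) [OF f]
        has_fps_expansion_complexify(1) [OF g]) (simp add: B0)
  then have "(?f \<circ> ?g) has_fps_expansion complex_fps (A oo B)"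
    by (simp add: complex_fps_compose)
  from has_fps_expansion_Re [OF this]
  have *: "(\<lambda>t. Re (?f (?g (of_real t)))) has_fps_expansion (A oo B)" by (simp add: o_def)
  have "isCont g 0" using has_fps_expansion_imp_continuous [OF g, of UNIV] by simp
  moreover have "g 0 = 0" using has_fps_expansion_nth_0 [OF g] B0 by simp
  ultimately have lim: "(g \<longlongrightarrow> 0) (nhds 0)"
    by (metis continuous_at tendsto_nhds_iff)
  have "eventually (\<lambda>t. ?f (of_real (g t)) = of_real (f (g t))) (nhds 0)"
    using has_fps_expansion_complexify(2) [OF f] lim
    by (rule eventually_compose_filterlim)
  with has_fps_expansion_complexify(2) [OF g]
  have "eventually (\<lambda>t. Re (?f (?g (of_real t))) = f (g t)) (nhds 0)"
    by eventually_elim simp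
  then show ?thesis using * by (rule has_fps_expansion_transfer)
qed

lemma has_fps_expansion_compose_at:
  fixes f g :: "real \<Rightarrow> real"
  assumes f: "(\<lambda>t. f (g x + t)) has_fps_expansion A" and g: "(\<lambda>t. g (x + t)) has_fps_expansion B"
  shows "(\<lambda>t. f (g (x + t))) has_fps_expansion (A oo (B - fps_const (g x)))"
proof -
  have "(\<lambda>t. g (x + t) - g x) has_fps_expansion B - fps_const (g x)"
    by (intro has_fps_expansion_diff g has_fps_expansion_const)
  from has_fps_expansion_compose_real [OF f this] has_fps_expansion_nth_0 [OF g]
  show ?thesis by simp
qed

lemma has_fps_expansion_has_real_derivative:
  fixes f :: "real \<Rightarrow> real"
  assumes "(\<lambda>t. f (x + t)) has_fps_expansion A"
  shows "(f has_real_derivative A $ 1) (at x)"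
proof -
  have pos: "fps_conv_radius A > 0" and ev: "eventually (\<lambda>z. eval_fps A z = f (x + z)) (nhds 0)"
    using assms by (auto simp: has_fps_expansion_def)
  have "(eval_fps A has_real_derivative eval_fps (fps_deriv A) 0) (at 0)"
    using pos by (intro has_field_derivative_eval_fps) (simp add: zero_ereal_def)
  then have "((\<lambda>t. f (x + t)) has_real_derivative A $ 1) (at 0)"
    using DERIV_cong_ev [OF refl ev refl] by (simp add: eval_fps_at_0)
  then show ?thesis using DERIV_shift [of f "A $ 1" 0 x] by (simp add: add.commute)
qed

lemma has_fps_expansion_at_cong:
  fixes f g :: "real \<Rightarrow> real"
  assumes "eventually (\<lambda>y. f y = g y) (nhds x)" "(\<lambda>t. f (x + t)) has_fps_expansion A"
  shows "(\<lambda>t. g (x + t)) has_fps_expansion A"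
proof -
  have "((\<lambda>t. x + t) \<longlongrightarrow> x) (nhds 0)"
    by (rule tendsto_eq_intros filterlim_ident refl)+ simp
  from eventually_compose_filterlim [OF assms(1) this] assms(2) show ?thesis
    by (rule has_fps_expansion_transfer)
qed

text \<open>Cauchy estimates whose radius \<open>r\<close> and constant \<open>C\<close> do not
  depend on the centre \<open>z\<close>. A centre left of \<open>x\<close> but closer than
  \<open>r\<close> thus has an estimate whose disc reaches beyond \<open>x\<close>.\<close>

lemma fps_coeff_bound:
  fixes f :: "real \<Rightarrow> real"
  assumes f: "(\<lambda>t. f (x + t)) has_fps_expansion A"
  obtains r C where "r > 0" and
    "\<And>z B n. \<bar>z - x\<bar> < r \<Longrightarrow> (\<lambda>t. f (z + t)) has_fps_expansion B \<Longrightarrow> \<bar>B $ n\<bar> \<le> C / r ^ n"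
proof -
  let ?g = "eval_fps (complex_fps A)"
  have pos: "fps_conv_radius A > 0" using f by (auto simp: has_fps_expansion_def)
  have "eventually (\<lambda>t. ?g (of_real t) = of_real (f (x + t))) (nhds 0)"
    by (rule has_fps_expansion_complexify(2) [OF f])
  then obtain d where d: "d > 0" "\<And>t. \<bar>t\<bar> < d \<Longrightarrow> ?g (of_real t) = of_real (f (x + t))"
    unfolding eventually_nhds_metric by (auto simp: dist_real_def)
  obtain r0 where r0: "r0 > 0" "ereal r0 < fps_conv_radius A"
    using pos ereal_dense2 by (metis ereal_less(2) zero_ereal_def)
  \<comment> \<open>Discs of radius \<open>r\<close> about centres of modulus below \<open>r\<close>
    stay in the disc of radius \<open>2 * r \<le> r0\<close>, where the series is bounded, and
    \<open>r < d\<close> leaves a real neighbourhood of each centre on which it agrees with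
    \<open>f\<close>.\<close>
  define r where "r = min d r0 / 2"
  have r: "r > 0" "r < d" "2 * r \<le> r0" using d(1) r0(1) by (auto simp: r_def)
  have sub: "cball 0 (2 * r) \<subseteq> eball (0::complex) (fps_conv_radius (complex_fps A))"
    proof
    fix s :: complex assume "s \<in> cball 0 (2 * r)"
    then have "ereal (norm s) \<le> ereal r0" using r(3) by simp
    then show "s \<in> eball 0 (fps_conv_radius (complex_fps A))"
      using r0(2) by (simp add: in_eball_iff del: ereal_less_eq)
  qed
  have holo: "?g holomorphic_on eball 0 (fps_conv_radius (complex_fps A))"
    by (intro holomorphic_on_eval_fps) auto
  then have "continuous_on (cball 0 (2 * r)) ?g"
    using sub by (meson continuous_on_subset holomorphic_on_imp_continuous_on)
  then have "bounded (?g ` cball 0 (2 * r))"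
    by (intro compact_imp_bounded compact_continuous_image) auto
  then obtain C where C: "\<And>s. s \<in> cball 0 (2 * r) \<Longrightarrow> norm (?g s) \<le> C"
    unfolding bounded_iff by (metis imageI)
  show ?thesis
  proof (rule that [OF r(1)])
    fix z B n assume z: "\<bar>z - x\<bar> < r" and B: "(\<lambda>t. f (z + t)) has_fps_expansion B"
    define w where "w = complex_of_real (z - x)"
    have w: "norm w < r" using z by (simp add: w_def flip: of_real_diff)
    have sub': "cball w r \<subseteq> cball 0 (2 * r)"
      using w by (auto simp: subset_iff dist_norm) (smt (verit) norm_minus_commute norm_triangle_sub)
    have g_an: "?g analytic_on {w}"
      using holo sub sub' r(1) open_eball
      by (metis analytic_on_open analytic_on_subset centre_in_cball empty_subsetI insert_subset less_imp_le subset_iff)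
    define E where "E = fps_expansion ?g w"
    have E: "(\<lambda>s. ?g (w + s)) has_fps_expansion E"
      unfolding E_def by (rule analytic_at_imp_has_fps_expansion [OF g_an])
    have "(\<lambda>t. Re (?g (w + of_real t))) has_fps_expansion Re_fps E"
      by (rule has_fps_expansion_Re [OF E])
    moreover have "eventually (\<lambda>t. Re (?g (w + of_real t)) = f (z + t)) (nhds 0)"
    proof -
      have "eventually (\<lambda>t. \<bar>t\<bar> < d - r) (nhds (0::real))"
        using r(2) by (auto simp: eventually_nhds_metric dist_real_def intro!: exI[of _ "d - r"])
      then show ?thesis
      proof eventually_elim
        case (elim t)
        then have "?g (of_real (z - x + t)) = of_real (f (x + (z - x + t)))"
          using z by (intro d(2)) linarith
        then show ?case by (simp add: w_def)
      qed
    qed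
    ultimately have "(\<lambda>t. f (z + t)) has_fps_expansion Re_fps E"
      by (rule has_fps_expansion_transfer [rotated])
    then have BE: "B $ n = Re (E $ n)"
      using has_fps_expansion_unique [OF B] by simp
    have En: "E $ n = (deriv ^^ n) ?g w / fact n" by (simp add: E_def fps_expansion_def)
    have "norm ((deriv ^^ n) ?g w) \<le> fact n * C / r ^ n"
    proof (rule Cauchy_inequality)
      show "?g holomorphic_on ball w r"
        using holo sub sub' by (meson ball_subset_cball holomorphic_on_subset subset_trans)
      show "continuous_on (cball w r) ?g"
        using holo sub sub' by (meson continuous_on_subset holomorphic_on_imp_continuous_on subset_trans)
      show "0 < r" by fact
      fix s assume "norm (w - s) = r"
      then show "norm (?g s) \<le> C" using sub' by (intro C) (auto simp: dist_norm)
    qed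
    then have "norm (E $ n) \<le> C / r ^ n" by (simp add: En norm_divide field_simps)
    then show "\<bar>B $ n\<bar> \<le> C / r ^ n" using abs_Re_le_cmod [of "E $ n"] BE by simp
  qed
qed

lemma has_fps_expansion_inverse_function:
  fixes f :: "real \<Rightarrow> real"
  assumes f: "(\<lambda>t. f (x + t)) has_fps_expansion A" and A1: "A $ 1 \<noteq> 0"
  obtains g B where "(\<lambda>t. g (f x + t)) has_fps_expansion B" "g (f x) = x"
    "eventually (\<lambda>y. f (g y) = y) (nhds (f x))" "eventually (\<lambda>t. g (f t) = t) (nhds x)"
proof -
  let ?f = "eval_fps (complex_fps A)"
  define U where "U = eball (0::complex) (fps_conv_radius (complex_fps A))"
  have pos: "fps_conv_radius A > 0" using f by (auto simp: has_fps_expansion_def)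
  have U: "0 \<in> U" "open U" using pos by (auto simp: U_def zero_ereal_def)
  have holo: "?f holomorphic_on U" unfolding U_def by (intro holomorphic_on_eval_fps) auto
  have "deriv ?f 0 = eval_fps (fps_deriv (complex_fps A)) 0"
    using pos by (intro DERIV_imp_deriv has_field_derivative_eval_fps) (simp add: zero_ereal_def)
  then have "deriv ?f 0 \<noteq> 0" using A1 by (simp add: eval_fps_at_0)
  from has_complex_derivative_locally_injective [OF holo U this]
  obtain r where r: "r > 0" "ball 0 r \<subseteq> U" "inj_on ?f (ball 0 r)" by metis
  have holo': "?f holomorphic_on ball 0 r" using holo r(2) holomorphic_on_subset by blast
  obtain h where h: "h holomorphic_on ?f ` ball 0 r" "\<And>z. z \<in> ball 0 r \<Longrightarrow> h (?f z) = z"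
    using holomorphic_has_inverse [OF holo' open_ball r(3)] by metis
  have op: "open (?f ` ball 0 r)" by (rule open_mapping_thm3 [OF holo' open_ball r(3)])
  have "eventually (\<lambda>t. ?f (of_real t) = of_real (f (x + t))) (nhds 0)"
    by (rule has_fps_expansion_complexify(2) [OF f])
  then obtain d0 where d0: "d0 > 0" "\<And>t. \<bar>t\<bar> < d0 \<Longrightarrow> ?f (of_real t) = of_real (f (x + t))"
    unfolding eventually_nhds_metric by (auto simp: dist_real_def)
  define d where "d = min d0 r"
  have d: "d > 0" "d \<le> r" "\<And>t. \<bar>t\<bar> < d \<Longrightarrow> ?f (of_real t) = of_real (f (x + t))"
    using d0 r(1) by (auto simp: d_def)
  \<comment> \<open>Taking the real part loses nothing: at \<open>f t\<close> with \<open>t\<close>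
    near \<open>x\<close> the complex inverse has the real value \<open>t - x\<close>.\<close>
  define g where "g y = x + Re (h (of_real y))" for y
  have gf: "g (f t) = t" if "t \<in> ball x d" for t
  proof -
    have t: "\<bar>t - x\<bar> < d" using that by (simp add: dist_real_def abs_minus_commute)
    then have "of_real (f t) = ?f (of_real (t - x))" using d(3)[OF t] by simp
    then have "h (of_real (f t)) = of_real (t - x)"
      using h(2)[of "of_real (t - x)"] t d(2) by (simp flip: of_real_diff)
    then show ?thesis by (simp add: g_def)
  qed
  have cont: "continuous_on (ball x d) f"
  proof -
    have "continuous_on (ball x d) (\<lambda>t. Re (?f (of_real (t - x))))"
      using d(2) by (intro continuous_intros continuous_on_compose2
          [OF holomorphic_on_imp_continuous_on [OF holo']])
        (auto simp: dist_real_def abs_minus_commute simp flip: of_real_diff)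
    then show ?thesis
      by (rule continuous_on_eq) (use d(3) in \<open>auto simp: dist_real_def abs_minus_commute simp flip: of_real_diff\<close>)
  qed
  \<comment> \<open>The complex open mapping theorem yields complex preimages only; real ones,
    needed for \<open>f (g y) = y\<close>, come from the openness of this real image.\<close>
  have opr: "open (f ` ball x d)"
    by (rule injective_into_1d_imp_open_map_UNIV [OF open_ball cont inj_on_inverseI [where g = g] subset_refl])
      (rule gf)
  have fx: "?f 0 = of_real (f x)" using d(3)[of 0] d(1) by simp
  have "of_real (f x) \<in> ?f ` ball 0 r" using fx r(1) by (metis centre_in_ball imageI)
  then have "h analytic_on {of_real (f x)}" using h(1) op
    by (meson analytic_at)
  then have "(\<lambda>s. h (of_real (f x) + s)) has_fps_expansion fps_expansion h (of_real (f x))"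
    by (rule analytic_at_imp_has_fps_expansion)
  from has_fps_expansion_Re [OF this]
  have "(\<lambda>t. x + Re (h (of_real (f x) + of_real t)))
      has_fps_expansion (fps_const x + Re_fps (fps_expansion h (of_real (f x))))"
    by (intro has_fps_expansion_add has_fps_expansion_const)
  then have 1: "(\<lambda>t. g (f x + t)) has_fps_expansion (fps_const x + Re_fps (fps_expansion h (of_real (f x))))"
    by (simp add: g_def)
  have 2: "g (f x) = x" using gf[of x] d(1) by simp
  have 3: "eventually (\<lambda>y. f (g y) = y) (nhds (f x))"
  proof -
    have "eventually (\<lambda>y. y \<in> f ` ball x d) (nhds (f x))"
      using d(1) by (intro eventually_nhds_in_open opr) auto
    then show ?thesis by eventually_elim (auto simp: gf)
  qed
  have 4: "eventually (\<lambda>t. g (f t) = t) (nhds x)"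
  proof -
    have "eventually (\<lambda>t. t \<in> ball x d) (nhds x)"
      using d(1) by (intro eventually_nhds_in_open) auto
    then show ?thesis by eventually_elim (auto simp: gf)
  qed
  from 1 2 3 4 show ?thesis by (rule that)
qed

section \<open>The Cauchy transform outside the support\<close>

text \<open>The Taylor series of \<open>G M\<close> at \<open>z\<close>, from the geometric
  expansion of the kernel. Left of the support its coefficients are the moments, from the first on,
  of the positive function \<open>1 / (x - z)\<close>.\<close>

definition cauchy_fps :: "real measure \<Rightarrow> real \<Rightarrow> real fps" where
  "cauchy_fps M z = Abs_fps (\<lambda>n. \<integral>x. (1 / (x - z)) ^ Suc n \<partial>M)"

lemma cauchy_fps_nth: "cauchy_fps M z $ n = (\<integral>x. (1 / (x - z)) ^ Suc n \<partial>M)"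
  by (simp add: cauchy_fps_def)

text \<open>The complement of the support is a possibly uncountable union of open null sets;
  Lindelof's theorem makes it countable.\<close>

lemma AE_msupport:
  assumes "sets M = sets borel"
  shows "AE x in M. x \<in> msupport M"
proof -
  define \<U> where "\<U> = {U :: real set. open U \<and> emeasure M U = 0}"
  obtain \<V> where V: "\<V> \<subseteq> \<U>" "countable \<V>" "\<Union>\<V> = \<Union>\<U>"
    using Lindelof[of \<U>] unfolding \<U>_def by blast
  have "(\<Union>U\<in>\<V>. U) \<in> null_sets M"
    using V(1,2) assms by (intro null_sets_UN') (auto simp: \<U>_def null_sets_def)
  moreover have "- msupport M \<subseteq> \<Union>\<V>"
    unfolding V(3) by (auto simp: msupport_def \<U>_def)
  ultimately show ?thesis
    by (intro AE_I'[of "\<Union>\<V>"]) auto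
qed

lemma
  assumes "compactly_supported M"
  shows AE_supp: "AE x in M. supp_minus M \<le> x \<and> x \<le> supp_plus M"
    and supp_minus_in_msupport: "supp_minus M \<in> msupport M"
    and supp_minus_le_supp_plus: "supp_minus M \<le> supp_plus M"
proof -
  interpret real_distribution M using assms by (simp add: compactly_supported_def)
  have c: "compact (msupport M)" using assms by (simp add: compactly_supported_def)
  have AE: "AE x in M. x \<in> msupport M" by (rule AE_msupport) simp
  have ne: "msupport M \<noteq> {}"
  proof
    assume "msupport M = {}"
    then have "AE x in M. False" using AE by simp
    then show False using AE_const by simp
  qed
  have bdd: "bdd_below (msupport M)" "bdd_above (msupport M)"
    using c by (auto intro: bounded_imp_bdd_below bounded_imp_bdd_above compact_imp_bounded)
  show "AE x in M. supp_minus M \<le> x \<and> x \<le> supp_plus M"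
    using AE unfolding supp_minus_def supp_plus_def
    by eventually_elim (auto intro: cInf_lower cSup_upper bdd)
  show i: "supp_minus M \<in> msupport M"
    unfolding supp_minus_def using c ne bdd by (intro closed_contains_Inf compact_imp_closed)
  show "supp_minus M \<le> supp_plus M"
    unfolding supp_plus_def using i bdd by (intro cSup_upper)
qed

text \<open>The expansion at points off the support is the case \<open>b = c\<close>, the one at infinity \<open>b = 1\<close>.\<close>

lemma has_fps_expansion_integral_geometric:
  fixes b c :: "real \<Rightarrow> real"
  assumes M: "prob_space M" and meas [measurable]: "b \<in> borel_measurable M" "c \<in> borel_measurable M"
    and C: "AE x in M. \<bar>c x\<bar> \<le> C" and B: "AE x in M. \<bar>b x\<bar> \<le> B"
  shows "(\<lambda>t. \<integral>x. b x / (1 - c x * t) \<partial>M) has_fps_expansion Abs_fps (\<lambda>n. \<integral>x. b x * c x ^ n \<partial>M)"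
proof -
  interpret prob_space M by fact
  \<comment> \<open>The maximum with 1 makes \<open>1 / C'\<close> a legitimate radius even when
    \<open>C\<close> is zero.\<close>
  define C' where "C' = max C 1"
  have C': "C' > 0" "AE x in M. \<bar>c x\<bar> \<le> C'" using C by (auto simp: C'_def)
  have bnd: "AE x in M. norm (b x * c x ^ n) \<le> B * C' ^ n" for n
    using B C'(2)
  proof eventually_elim
    case (elim x)
    then have "\<bar>b x\<bar> * \<bar>c x\<bar> ^ n \<le> B * C' ^ n" by (intro mult_mono power_mono) auto
    then show ?case by (simp add: abs_mult power_abs)
  qed
  have int: "integrable M (\<lambda>x. b x * c x ^ n)" for n
    using bnd by (intro integrable_const_bound) auto
  have "AE x in M. B \<ge> 0" using B by eventually_elim linarith
  then have B0: "B \<ge> 0" by simp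
  have sums: "(\<lambda>n. (\<integral>x. b x * c x ^ n \<partial>M) * t ^ n) sums (\<integral>x. b x / (1 - c x * t) \<partial>M)"
    if t: "\<bar>t\<bar> < 1 / C'" for t
  proof -
    have q: "C' * \<bar>t\<bar> < 1" using t C'(1) by (simp add: field_simps)
    have AE_s: "AE x in M. (\<lambda>n. b x * c x ^ n * t ^ n) sums (b x / (1 - c x * t)) \<and>
        summable (\<lambda>n. norm (b x * c x ^ n * t ^ n))"
      using C'(2)
    proof eventually_elim
      case (elim x)
      have "\<bar>c x * t\<bar> \<le> C' * \<bar>t\<bar>" using elim by (simp add: abs_mult mult_right_mono)
      then have n1: "norm (c x * t) < 1" using q by simp
      have "(\<lambda>n. b x * (c x * t) ^ n) sums (b x * (1 / (1 - c x * t)))"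
        by (intro sums_mult geometric_sums n1)
      moreover have "summable (\<lambda>n. \<bar>b x\<bar> * (norm (c x * t)) ^ n)"
        using n1 by (intro summable_mult summable_geometric) simp
      ultimately show ?case by (simp add: power_mult_distrib mult.assoc abs_mult power_abs)
    qed
    have "(\<lambda>n. \<integral>x. b x * c x ^ n * t ^ n \<partial>M) sums (\<integral>x. (\<Sum>n. b x * c x ^ n * t ^ n) \<partial>M)"
    proof (rule sums_integral)
      show "integrable M (\<lambda>x. b x * c x ^ n * t ^ n)" for n using int by simp
      show "AE x in M. summable (\<lambda>n. norm (b x * c x ^ n * t ^ n))" using AE_s by auto
      have "summable (\<lambda>n. B * (C' * \<bar>t\<bar>) ^ n)"
        using q C'(1) by (intro summable_mult summable_geometric) (simp add: abs_mult)
      then show "summable (\<lambda>n. \<integral>x. norm (b x * c x ^ n * t ^ n) \<partial>M)"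
      proof (rule summable_comparison_test [rotated], intro exI allI impI)
        fix n :: nat
        have "AE x in M. norm (b x * c x ^ n * t ^ n) \<le> B * (C' * \<bar>t\<bar>) ^ n"
          using bnd[of n]
        proof eventually_elim
          case (elim x)
          then have "norm (b x * c x ^ n) * \<bar>t\<bar> ^ n \<le> B * C' ^ n * \<bar>t\<bar> ^ n"
            by (intro mult_right_mono) auto
          then show ?case by (simp add: abs_mult power_abs power_mult_distrib mult_ac)
        qed
        then have "(\<integral>x. norm (b x * c x ^ n * t ^ n) \<partial>M) \<le> (\<integral>x. B * (C' * \<bar>t\<bar>) ^ n \<partial>M)"
          using int[of n] by (intro integral_mono_AE) (auto intro!: integrable_norm integrable_mult_left)
        then show "norm (\<integral>x. norm (b x * c x ^ n * t ^ n) \<partial>M) \<le> B * (C' * \<bar>t\<bar>) ^ n"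
          by (simp add: prob_space)
      qed
    qed
    also have "(\<integral>x. (\<Sum>n. b x * c x ^ n * t ^ n) \<partial>M) = (\<integral>x. b x / (1 - c x * t) \<partial>M)"
      using AE_s by (intro integral_cong_AE) (auto simp: sums_iff)
    finally show ?thesis by simp
  qed
  define A where "A = Abs_fps (\<lambda>n. \<integral>x. b x * c x ^ n \<partial>M)"
  have "conv_radius (fps_nth A) \<ge> ereal (1 / C')"
  proof (rule conv_radius_geI_ex')
    fix r assume "0 < r" "ereal r < ereal (1 / C')"
    then have "\<bar>r\<bar> < 1 / C'" by simp
    from sums[OF this] show "summable (\<lambda>n. A $ n * of_real r ^ n)"
      by (auto simp: A_def sums_iff)
  qed
  moreover have "ereal (1 / C') > 0" using C'(1) by simp
  ultimately have "fps_conv_radius A > 0" unfolding fps_conv_radius_def by (rule order.strict_trans2 [rotated])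
  moreover have "eventually (\<lambda>t. \<bar>t\<bar> < 1 / C') (nhds (0::real))"
    using C'(1) by (auto simp: eventually_nhds_metric dist_real_def intro!: exI[of _ "1 / C'"])
  then have "eventually (\<lambda>t. eval_fps A t = (\<integral>x. b x / (1 - c x * t) \<partial>M)) (nhds 0)"
    by eventually_elim (use sums in \<open>auto simp: eval_fps_def sums_iff A_def\<close>)
  ultimately show ?thesis by (simp add: has_fps_expansion_def A_def)
qed

locale compact_distribution = real_distribution M for M :: "real measure" +
  assumes compact_msupport: "compact (msupport M)"
begin

abbreviation "S \<equiv> {supp_minus M..supp_plus M}"

lemma csupp: "compactly_supported M"
  using compact_msupport real_distribution_axioms by (simp add: compactly_supported_def)

lemma prob_UNIV: "prob UNIV = 1" using prob_space by simp

lemmas AE_S = AE_supp [OF csupp]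

lemma le: "supp_minus M \<le> supp_plus M" by (rule supp_minus_le_supp_plus [OF csupp])

text \<open>The upper bound gives integrability of all powers, the lower one strict positivity of
  the derivative of \<open>G\<close>. Excluding \<open>x = z\<close> keeps the default value of
  division by zero out of the computations.\<close>

lemma kernel_bounds:
  assumes "z \<notin> S"
  obtains a b where "a > 0" "b > 0" "AE x in M. a \<le> \<bar>1 / (x - z)\<bar> \<and> \<bar>1 / (x - z)\<bar> \<le> b \<and> x \<noteq> z"
proof (cases "z < supp_minus M")
  case True
  have "AE x in M. 1 / (supp_plus M - z) \<le> \<bar>1 / (x - z)\<bar> \<and> \<bar>1 / (x - z)\<bar> \<le> 1 / (supp_minus M - z) \<and> x \<noteq> z"
    using AE_S by eventually_elim (use True in \<open>auto simp: divide_simps\<close>)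
  then show ?thesis using True le by (intro that) auto
next
  case False
  then have z: "z > supp_plus M" using assms by auto
  have "AE x in M. 1 / (z - supp_minus M) \<le> \<bar>1 / (x - z)\<bar> \<and> \<bar>1 / (x - z)\<bar> \<le> 1 / (z - supp_plus M) \<and> x \<noteq> z"
    using AE_S by eventually_elim (use z in \<open>auto simp: divide_simps\<close>)
  then show ?thesis using z le by (intro that) auto
qed

lemma integrable_kernel_power:
  assumes "z \<notin> S"
  shows "integrable M (\<lambda>x. (1 / (x - z)) ^ n)"
proof -
  obtain a b where ab: "a > 0" "b > 0" "AE x in M. a \<le> \<bar>1 / (x - z)\<bar> \<and> \<bar>1 / (x - z)\<bar> \<le> b \<and> x \<noteq> z"
    using kernel_bounds [OF assms] by blast
  have "AE x in M. norm ((1 / (x - z)) ^ n) \<le> b ^ n"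
    using ab(3) proof eventually_elim
    case (elim x)
    then have "\<bar>1 / (x - z)\<bar> ^ n \<le> b ^ n" by (intro power_mono) auto
    then show ?case by (simp only: real_norm_def power_abs)
  qed
  then show ?thesis by (intro integrable_const_bound) auto
qed

lemma G_has_fps_expansion:
  assumes "z \<notin> S"
  shows "(\<lambda>t. G M (z + t)) has_fps_expansion cauchy_fps M z"
proof -
  obtain a b where ab: "a > 0" "b > 0" "AE x in M. a \<le> \<bar>1 / (x - z)\<bar> \<and> \<bar>1 / (x - z)\<bar> \<le> b \<and> x \<noteq> z"
    using kernel_bounds [OF assms] by blast
  have bd: "AE x in M. \<bar>1 / (x - z)\<bar> \<le> b" using ab(3) by eventually_elim simp
  have "(\<lambda>t. \<integral>x. 1 / (x - z) / (1 - 1 / (x - z) * t) \<partial>M)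
      has_fps_expansion Abs_fps (\<lambda>n. \<integral>x. 1 / (x - z) * (1 / (x - z)) ^ n \<partial>M)"
    by (rule has_fps_expansion_integral_geometric [OF prob_space_axioms _ _ bd bd]) auto
  also have "(\<lambda>t. \<integral>x. 1 / (x - z) / (1 - 1 / (x - z) * t) \<partial>M) = (\<lambda>t. G M (z + t))"
  proof
    fix t
    have "AE x in M. 1 / (x - z) / (1 - 1 / (x - z) * t) = 1 / (x - (z + t))"
      using ab(3) by eventually_elim (auto simp: divide_simps)
    then show "(\<integral>x. 1 / (x - z) / (1 - 1 / (x - z) * t) \<partial>M) = G M (z + t)"
      unfolding G_def by (intro integral_cong_AE) auto
  qed
  also have "Abs_fps (\<lambda>n. \<integral>x. 1 / (x - z) * (1 / (x - z)) ^ n \<partial>M) = cauchy_fps M z"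
    by (simp add: cauchy_fps_def)
  finally show ?thesis .
qed

lemma G_eq_nth: "G M z = cauchy_fps M z $ 0"
  by (simp add: G_def cauchy_fps_nth)

lemma DERIV_G: "z \<notin> S \<Longrightarrow> (G M has_real_derivative cauchy_fps M z $ 1) (at z)"
  by (rule has_fps_expansion_has_real_derivative [OF G_has_fps_expansion])

lemma isCont_G: "z \<notin> S \<Longrightarrow> isCont (G M) z"
  using DERIV_G DERIV_isCont by blast

lemma cauchy_fps_1_pos:
  assumes "z \<notin> S"
  shows "cauchy_fps M z $ 1 > 0"
proof -
  obtain a b where ab: "a > 0" "b > 0" "AE x in M. a \<le> \<bar>1 / (x - z)\<bar> \<and> \<bar>1 / (x - z)\<bar> \<le> b \<and> x \<noteq> z"
    using kernel_bounds [OF assms] by blast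
  have "AE x in M. a\<^sup>2 \<le> (1 / (x - z)) ^ 2"
    using ab(3) by eventually_elim (use ab(1) in \<open>auto intro!: abs_le_square_iff[THEN iffD1]\<close>)
  then have "a\<^sup>2 \<le> (\<integral>x. (1 / (x - z)) ^ 2 \<partial>M)"
    using integrable_kernel_power [OF assms] by (intro integral_ge_const)
  moreover have "a\<^sup>2 > 0" using ab(1) by simp
  ultimately show ?thesis by (simp add: cauchy_fps_nth numeral_2_eq_2)
qed

section \<open>Kernel moments left of the support\<close>

lemma cauchy_fps_pos:
  assumes "z < supp_minus M"
  shows "cauchy_fps M z $ n > 0"
proof -
  have "AE x in M. (1 / (supp_plus M - z)) ^ Suc n \<le> (1 / (x - z)) ^ Suc n"
    using AE_S by eventually_elim (use assms in \<open>auto intro!: power_mono divide_left_mono simp del: power_Suc\<close>)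
  then have "(1 / (supp_plus M - z)) ^ Suc n \<le> (\<integral>x. (1 / (x - z)) ^ Suc n \<partial>M)"
    using assms by (intro integral_ge_const integrable_kernel_power) auto
  moreover have "(1 / (supp_plus M - z)) ^ Suc n > 0" using assms le by (intro zero_less_power) auto
  ultimately show ?thesis by (simp add: cauchy_fps_nth)
qed

lemma cauchy_fps_le:
  assumes "z < supp_minus M"
  shows "cauchy_fps M z $ n \<le> (1 / (supp_minus M - z)) ^ Suc n"
proof -
  have "AE x in M. (1 / (x - z)) ^ Suc n \<le> (1 / (supp_minus M - z)) ^ Suc n"
    using AE_S by eventually_elim (use assms in \<open>auto intro!: power_mono divide_left_mono simp del: power_Suc\<close>)
  then show ?thesis unfolding cauchy_fps_nth
    using assms by (intro integral_le_const integrable_kernel_power) auto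
qed

text \<open>Cauchy-Schwarz, obtained by integrating the \<open>n\<close>-th kernel power times the
  square of \<open>p * (1 / (x - z)) - q\<close>. With these \<open>p\<close> and \<open>q\<close>
  the expanded integral is \<open>m n\<close> times the difference claimed non-negative.\<close>

lemma kernel_moment_log_convex:
  assumes "z < supp_minus M"
  defines "m \<equiv> \<lambda>n. \<integral>x. (1 / (x - z)) ^ n \<partial>M"
  shows "(m (Suc n))\<^sup>2 \<le> m n * m (Suc (Suc n))"
proof -
  have int: "integrable M (\<lambda>x. (1 / (x - z)) ^ n)" for n
    using assms(1) by (intro integrable_kernel_power) auto
  have pos: "m n > 0"
  proof (cases n)
    case 0 then show ?thesis by (simp add: m_def prob_UNIV)
  next
    case (Suc k) then show ?thesis using cauchy_fps_pos [OF assms(1), of k] by (simp add: m_def cauchy_fps_nth)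
  qed
  define p q where "p = m n" and "q = m (Suc n)"
  have "0 \<le> (\<integral>x. (1 / (x - z)) ^ n * (p * (1 / (x - z)) - q)\<^sup>2 \<partial>M)"
  proof (intro integral_nonneg_AE)
    show "AE x in M. 0 \<le> (1 / (x - z)) ^ n * (p * (1 / (x - z)) - q)\<^sup>2"
      using AE_S by eventually_elim (use assms(1) in \<open>auto intro!: mult_nonneg_nonneg zero_le_power\<close>)
  qed
  also have "(\<integral>x. (1 / (x - z)) ^ n * (p * (1 / (x - z)) - q)\<^sup>2 \<partial>M)
     = (\<integral>x. p\<^sup>2 * (1 / (x - z)) ^ Suc (Suc n) - 2 * p * q * (1 / (x - z)) ^ Suc n + q\<^sup>2 * (1 / (x - z)) ^ n \<partial>M)"
    by (intro Bochner_Integration.integral_cong refl) (simp add: power2_eq_square algebra_simps)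
  also have "\<dots> = p\<^sup>2 * m (Suc (Suc n)) - 2 * p * q * m (Suc n) + q\<^sup>2 * m n"
    unfolding m_def
    by (simp only: Bochner_Integration.integral_add Bochner_Integration.integral_diff
        Bochner_Integration.integrable_diff integrable_mult_right int integral_mult_right_zero)
  also have "\<dots> = p * (m n * m (Suc (Suc n)) - (m (Suc n))\<^sup>2)"
    by (simp add: p_def q_def power2_eq_square algebra_simps)
  finally show ?thesis using pos by (simp add: p_def zero_le_mult_iff)
qed

lemma inverse_cauchy_fps_nonpos:
  assumes "z < supp_minus M" "n \<ge> 1"
  shows "inverse (cauchy_fps M z) $ n \<le> 0"
proof (rule Kaluza_inverse_nonpos [OF cauchy_fps_pos [OF assms(1)] _ assms(2)])
  show "(cauchy_fps M z $ Suc n)\<^sup>2 \<le> cauchy_fps M z $ n * cauchy_fps M z $ Suc (Suc n)" for n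
    unfolding cauchy_fps_nth by (rule kernel_moment_log_convex [OF assms(1)])
qed

text \<open>The case of the moments 0, 1 and 2, where the zeroth moment is the total mass one. It
  settles degree one of \<open>- u - 1 / G M u\<close>, for which Kaluza's theorem alone would give
  only the lower bound -1.\<close>

lemma G_squared_le: "z < supp_minus M \<Longrightarrow> (G M z)\<^sup>2 \<le> cauchy_fps M z $ 1"
  using kernel_moment_log_convex [of z 0] by (simp add: cauchy_fps_nth G_def prob_UNIV)

lemma cauchy_fps_ge:
  assumes "z < supp_minus M" "supp_minus M < u"
  shows "measure M {..<u} * (1 / (u - z)) ^ Suc n \<le> cauchy_fps M z $ n"
proof -
  have "AE x in M. indicator {..<u} x * (1 / (u - z)) ^ Suc n \<le> (1 / (x - z)) ^ Suc n"
    using AE_S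
    by eventually_elim
      (use assms in \<open>auto simp: indicator_def intro!: power_mono divide_left_mono zero_le_power mult_pos_pos simp del: power_Suc\<close>)
  then have "(\<integral>x. indicator {..<u} x * (1 / (u - z)) ^ Suc n \<partial>M) \<le> (\<integral>x. (1 / (x - z)) ^ Suc n \<partial>M)"
    using assms by (intro integral_mono_AE integrable_kernel_power integrable_mult_left integrable_real_indicator)
       (auto simp: emeasure_eq_measure)
  then show ?thesis by (simp add: cauchy_fps_nth)
qed

text \<open>Every neighbourhood of the lower end point has positive mass, so for each
  \<open>u\<close> beyond it the coefficients at \<open>z\<close> are at least a positive multiple
  of \<open>(1 / (u - z)) ^ n\<close>. Decay with a radius \<open>r\<close> that reaches past the
  end point is impossible: choose \<open>u\<close> strictly between that point and
  \<open>z + r\<close>.\<close>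

lemma cauchy_fps_radius_contradiction:
  assumes z: "z < supp_minus M" "supp_minus M < z + r" and C: "\<And>n. cauchy_fps M z $ n \<le> C / r ^ n"
  shows False
proof -
  define u where "u = (supp_minus M + (z + r)) / 2"
  have u: "supp_minus M < u" "u - z < r" "u - z > 0" using z by (auto simp: u_def field_simps)
  have "emeasure M {..<u} > 0"
    using supp_minus_in_msupport [OF csupp] u(1) by (auto simp: msupport_def)
  then have p: "measure M {..<u} > 0" by (simp add: emeasure_eq_measure)
  define q where "q = (u - z) / r"
  have q: "0 < q" "q < 1" using u by (auto simp: q_def)
  have le: "measure M {..<u} / (u - z) \<le> C * q ^ n" for n
  proof -
    have "measure M {..<u} * (1 / (u - z)) ^ Suc n \<le> C / r ^ n"
      using cauchy_fps_ge [OF z(1) u(1), of n] C[of n] by linarith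
    then have "measure M {..<u} * (1 / (u - z)) ^ Suc n * (u - z) ^ n \<le> C / r ^ n * (u - z) ^ n"
      using u(3) by (intro mult_right_mono) auto
    then show ?thesis using u(3) by (simp add: q_def power_divide)
  qed
  have "(\<lambda>n. C * q ^ n) \<longlonglongrightarrow> C * 0"
    using q by (intro tendsto_intros LIMSEQ_realpow_zero) auto
  then have "measure M {..<u} / (u - z) \<le> C * 0"
    by (rule LIMSEQ_le_const) (use le in auto)
  then show False using p u(3) by (simp add: field_simps)
qed

section \<open>Monotonicity and boundary values of \<open>G\<close>\<close>

lemma G_pos: "z < supp_minus M \<Longrightarrow> G M z > 0"
  by (simp add: G_eq_nth cauchy_fps_pos)

lemma G_le: "z < supp_minus M \<Longrightarrow> G M z \<le> 1 / (supp_minus M - z)"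
  using cauchy_fps_le [of z 0] by (simp add: G_eq_nth)

lemma G_bounds_right:
  assumes "z > supp_plus M"
  shows "G M z < 0" "- 1 / (z - supp_plus M) \<le> G M z"
proof -
  have int: "integrable M (\<lambda>x. 1 / (x - z))" using integrable_kernel_power [of z 1] assms by simp
  have "AE x in M. 1 / (x - z) \<le> - (1 / (z - supp_minus M))"
    using AE_S by eventually_elim (use assms in \<open>auto simp: divide_simps\<close>)
  then have "G M z \<le> - (1 / (z - supp_minus M))" unfolding G_def by (intro integral_le_const int)
  also have "\<dots> < 0" using assms le by auto
  finally show "G M z < 0" .
  have "AE x in M. - 1 / (z - supp_plus M) \<le> 1 / (x - z)"
    using AE_S by eventually_elim (use assms in \<open>auto simp: divide_simps\<close>)
  then show "- 1 / (z - supp_plus M) \<le> G M z" unfolding G_def by (intro integral_ge_const int)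
qed

lemma G_strict_mono_left:
  assumes "z < w" "w < supp_minus M"
  shows "G M z < G M w"
  by (rule DERIV_pos_imp_increasing [OF assms(1)])
    (use assms in \<open>auto intro!: exI[of _ "cauchy_fps M _ $ 1"] DERIV_G cauchy_fps_1_pos\<close>)

lemma G_strict_mono_right:
  assumes "supp_plus M < z" "z < w"
  shows "G M z < G M w"
  by (rule DERIV_pos_imp_increasing [OF assms(2)])
    (use assms in \<open>auto intro!: exI[of _ "cauchy_fps M _ $ 1"] DERIV_G cauchy_fps_1_pos\<close>)

lemma inj_on_G: "inj_on (G M) (UNIV - S)"
proof -
  have "G M z \<noteq> G M w" if zw: "z < w" "z \<notin> S" "w \<notin> S" for z w
  proof -
    consider "w < supp_minus M" | "supp_plus M < z" | "z < supp_minus M" "supp_plus M < w"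
      using zw by force
    then show ?thesis
    proof cases
      case 1 then show ?thesis using G_strict_mono_left [OF zw(1)] by simp
    next
      case 2 then show ?thesis using G_strict_mono_right [OF _ zw(1)] by simp
    next
      case 3 then show ?thesis using G_pos [of z] G_bounds_right(1) [of w] by simp
    qed
  qed
  then show ?thesis by (intro linorder_inj_onI) auto
qed

lemma G_inv_G: "z \<notin> S \<Longrightarrow> G_inv M (G M z) = z"
  unfolding G_inv_def by (intro the_inv_into_f_f inj_on_G) auto

text \<open>\<open>G_minus\<close> is given by \<open>Lim\<close>, which says something only once
  convergence is known. Monotonicity identifies the limit with the supremum over the half-line, and
  strictness keeps it from being attained.\<close>

lemma tendsto_G_minus: "((\<lambda>z. ereal (G M z)) \<longlongrightarrow> G_minus M) (at_left (supp_minus M))"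
  and G_less_G_minus: "z < supp_minus M \<Longrightarrow> ereal (G M z) < G_minus M"
  and ex_G_eq_left: "\<lbrakk>0 < g; ereal g < G_minus M\<rbrakk> \<Longrightarrow> \<exists>z<supp_minus M. G M z = g"
proof -
  define l where "l = (SUP z\<in>{..<supp_minus M}. ereal (G M z))"
  have up: "ereal (G M z) < l" if z: "z < supp_minus M" for z
  proof -
    obtain w where w: "z < w" "w < supp_minus M" using dense [OF z] by blast
    have "ereal (G M z) < ereal (G M w)" using G_strict_mono_left w by simp
    also have "\<dots> \<le> l" unfolding l_def using w by (intro SUP_upper) auto
    finally show ?thesis .
  qed
  have lim: "((\<lambda>z. ereal (G M z)) \<longlongrightarrow> l) (at_left (supp_minus M))"
  proof (rule order_tendstoI)
    fix a assume "a < l"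
    then obtain w where w: "w < supp_minus M" "a < ereal (G M w)" unfolding l_def less_SUP_iff by auto
    have "eventually (\<lambda>z. z \<in> {w<..<supp_minus M}) (at_left (supp_minus M))"
      by (rule eventually_at_left_real [OF w(1)])
    then show "eventually (\<lambda>z. a < ereal (G M z)) (at_left (supp_minus M))"
    proof eventually_elim
      case (elim z)
      then have "G M w < G M z" using G_strict_mono_left by simp
      then have "ereal (G M w) < ereal (G M z)" by simp
      with w(2) show ?case by (rule less_trans)
    qed
  next
    fix a assume "l < a"
    have "eventually (\<lambda>z. z \<in> {supp_minus M - 1<..<supp_minus M}) (at_left (supp_minus M))"
      by (rule eventually_at_left_real) simp
    then show "eventually (\<lambda>z. ereal (G M z) < a) (at_left (supp_minus M))"
      by eventually_elim (use less_trans [OF up \<open>l < a\<close>] in simp)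
  qed
  have l: "G_minus M = l" unfolding G_minus_def by (intro tendsto_Lim lim) simp
  show "((\<lambda>z. ereal (G M z)) \<longlongrightarrow> G_minus M) (at_left (supp_minus M))" using lim l by simp
  show "z < supp_minus M \<Longrightarrow> ereal (G M z) < G_minus M" using up l by simp
  show "\<exists>z<supp_minus M. G M z = g" if g: "0 < g" "ereal g < G_minus M"
  proof -
    obtain w where w: "w < supp_minus M" "g < G M w" using g(2) unfolding l l_def less_SUP_iff by auto
    \<comment> \<open>At distance \<open>1 / g\<close> from the support the estimate
      \<open>G_le\<close> gives exactly the bound \<open>g\<close>, so \<open>v\<close> is a left
      end for the intermediate value theorem.\<close>
    define v where "v = supp_minus M - 1 / g"
    have v: "v < supp_minus M" "G M v \<le> g" using G_le [of v] g(1) by (auto simp: v_def)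
    have "v \<le> w" using w v G_strict_mono_left [of w v] by (cases "v \<le> w") auto
    moreover have "\<forall>x. v \<le> x \<and> x \<le> w \<longrightarrow> isCont (G M) x" using w(1) by (auto intro!: isCont_G)
    ultimately obtain y where "v \<le> y" "y \<le> w" "G M y = g" using IVT [of "G M" v g w] v(2) less_imp_le [OF w(2)] by blast
    then show ?thesis using w(1) by (intro exI[of _ y]) auto
  qed
qed

lemma G_plus_less_G: "z > supp_plus M \<Longrightarrow> G_plus M < ereal (G M z)"
  and ex_G_eq_right: "\<lbrakk>g < 0; G_plus M < ereal g\<rbrakk> \<Longrightarrow> \<exists>z>supp_plus M. G M z = g"
proof -
  define l where "l = (INF z\<in>{supp_plus M<..}. ereal (G M z))"
  have up: "l < ereal (G M z)" if z: "z > supp_plus M" for z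
  proof -
    obtain w where w: "w < z" "w > supp_plus M" using dense [OF z] by blast
    have "l \<le> ereal (G M w)" unfolding l_def using w by (intro INF_lower) auto
    also have "ereal (G M w) < ereal (G M z)" using G_strict_mono_right w by simp
    finally show ?thesis .
  qed
  have lim: "((\<lambda>z. ereal (G M z)) \<longlongrightarrow> l) (at_right (supp_plus M))"
  proof (rule order_tendstoI)
    fix a assume "l < a"
    then obtain w where w: "w > supp_plus M" "ereal (G M w) < a" unfolding l_def INF_less_iff by auto
    have "eventually (\<lambda>z. z \<in> {supp_plus M<..<w}) (at_right (supp_plus M))"
      by (rule eventually_at_right_real [OF w(1)])
    then show "eventually (\<lambda>z. ereal (G M z) < a) (at_right (supp_plus M))"
    proof eventually_elim
      case (elim z)
      then have "G M z < G M w" using G_strict_mono_right by simp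
      then have "ereal (G M z) < ereal (G M w)" by simp
      from this w(2) show ?case by (rule less_trans)
    qed
  next
    fix a assume "a < l"
    have "eventually (\<lambda>z. z \<in> {supp_plus M<..<supp_plus M + 1}) (at_right (supp_plus M))"
      by (rule eventually_at_right_real) simp
    then show "eventually (\<lambda>z. a < ereal (G M z)) (at_right (supp_plus M))"
      by eventually_elim (use less_trans [OF \<open>a < l\<close> up] in simp)
  qed
  have l: "G_plus M = l" unfolding G_plus_def by (intro tendsto_Lim lim) simp
  show "z > supp_plus M \<Longrightarrow> G_plus M < ereal (G M z)" using up l by simp
  show "\<exists>z>supp_plus M. G M z = g" if g: "g < 0" "G_plus M < ereal g"
  proof -
    obtain w where w: "w > supp_plus M" "G M w < g" using g(2) unfolding l l_def INF_less_iff by auto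
    define v where "v = supp_plus M - 1 / g"
    have v: "v > supp_plus M" "g \<le> G M v" using G_bounds_right(2) [of v] g(1) by (auto simp: v_def)
    have "w \<le> v" using w v G_strict_mono_right [of v w] by (cases "w \<le> v") auto
    moreover have "\<forall>x. w \<le> x \<and> x \<le> v \<longrightarrow> isCont (G M) x" using w(1) by (auto intro!: isCont_G)
    ultimately obtain y where "w \<le> y" "y \<le> v" "G M y = g" using IVT [of "G M" w g v] v(2) less_imp_le [OF w(2)] by blast
    then show ?thesis using w(1) by (intro exI[of _ y]) auto
  qed
qed

lemma G_minus_pos: "0 < G_minus M"
proof -
  have "0 < ereal (G M (supp_minus M - 1))" using G_pos by simp
  also have "\<dots> < G_minus M" by (rule G_less_G_minus) simp
  finally show ?thesis .
qed

lemma G_plus_neg: "G_plus M < 0"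
proof -
  have "G_plus M < ereal (G M (supp_plus M + 1))" by (rule G_plus_less_G) simp
  also have "\<dots> < 0" using G_bounds_right(1) by simp
  finally show ?thesis .
qed

section \<open>The interval \<open>D_hat\<close> and the inverse of \<open>G\<close>\<close>

lemma zero_in_D_hat: "0 \<in> D_hat M"
  using G_minus_pos G_plus_neg ereal_uminus_less_reorder [of "G_minus M" 0] ereal_less_uminus_reorder [of 0 "G_plus M"]
  by (simp add: D_hat_def flip: zero_ereal_def)

lemma D_hat_cases:
  assumes "t \<in> D_hat M" "t \<noteq> 0"
  obtains z where "z \<notin> S" "G M z = - t"
proof (cases "t < 0")
  case True
  then have "\<exists>z<supp_minus M. G M z = - t"
    using assms(1) ereal_uminus_less_reorder [of "G_minus M" "ereal t"]
    by (intro ex_G_eq_left) (auto simp: D_hat_def)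
  then show ?thesis using that by force
next
  case False
  then have "\<exists>z>supp_plus M. G M z = - t"
    using assms ereal_less_uminus_reorder [of "ereal t" "G_plus M"]
    by (intro ex_G_eq_right) (auto simp: D_hat_def)
  then show ?thesis using that by force
qed

lemma minus_in_D_hat:
  assumes "0 < g" "ereal g < G_minus M"
  shows "- g \<in> D_hat M"
proof -
  have "ereal (- g) < 0" using assms(1) by simp
  also have "0 < - G_plus M" using G_plus_neg ereal_less_uminus_reorder [of 0 "G_plus M"] by simp
  finally have "ereal (- g) < - G_plus M" .
  moreover have "- G_minus M < - ereal g" using assms(2) by (simp only: ereal_minus_less_minus)
  ultimately show ?thesis by (simp add: D_hat_def)
qed

lemma G_inv_props:
  assumes "0 < g" "ereal g < G_minus M"
  shows "G_inv M g < supp_minus M" "G M (G_inv M g) = g"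
proof -
  obtain z where z: "z < supp_minus M" "G M z = g" using ex_G_eq_left [OF assms] by blast
  then have "G_inv M g = z" using G_inv_G [of z] by auto
  then show "G_inv M g < supp_minus M" "G M (G_inv M g) = g" using z by auto
qed

lemma open_D_hat: "open (D_hat M)"
proof -
  have *: "D_hat M = ereal -` {- G_minus M<..<- G_plus M}" by (auto simp: D_hat_def)
  show ?thesis unfolding * by (intro open_vimage continuous_on_ereal continuous_on_id open_greaterThanLessThan)
qed

lemma is_interval_D_hat: "is_interval (D_hat M)"
  unfolding is_interval_1
proof (intro ballI allI impI)
  fix a b x assume ab: "a \<in> D_hat M" "b \<in> D_hat M" and "a \<le> x \<and> x \<le> b"
  then have "ereal a \<le> ereal x" "ereal x \<le> ereal b" by simp_all
  then show "x \<in> D_hat M" using ab unfolding D_hat_def by (auto intro: less_le_trans le_less_trans simp del: ereal_less_eq)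
qed

text \<open>The local analytic inverse is continuous, so near \<open>G M z\<close> its values avoid
  the support interval; there injectivity of \<open>G M\<close> identifies it with the global
  \<open>G_inv M\<close>.\<close>

lemma G_inv_has_fps_expansion:
  assumes "z \<notin> S"
  obtains B where "(\<lambda>t. G_inv M (G M z + t)) has_fps_expansion B"
proof -
  obtain g B where g: "(\<lambda>t. g (G M z + t)) has_fps_expansion B" "g (G M z) = z"
    "eventually (\<lambda>y. G M (g y) = y) (nhds (G M z))"
    using has_fps_expansion_inverse_function [OF G_has_fps_expansion [OF assms]] cauchy_fps_1_pos [OF assms]
    by (metis less_irrefl)
  have "isCont g (G M z)"
    using DERIV_isCont [OF has_fps_expansion_has_real_derivative [OF g(1)]] .
  then have "(g \<longlongrightarrow> z) (nhds (G M z))" using g(2) by (metis continuous_at tendsto_nhds_iff)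
  moreover have "open (- S)" "z \<in> - S" using assms by auto
  ultimately have "eventually (\<lambda>y. g y \<in> - S) (nhds (G M z))" by (rule topological_tendstoD)
  with g(3) have "eventually (\<lambda>y. g y = G_inv M y) (nhds (G M z))"
    by eventually_elim (metis ComplD G_inv_G)
  from has_fps_expansion_at_cong [OF this g(1)] show ?thesis by (rule that)
qed

end

section \<open>The R-transform\<close>

context compact_distribution
begin

lemma R_hat_has_fps_expansion:
  assumes "t \<in> D_hat M" "t \<noteq> 0"
  shows "\<exists>A. (\<lambda>s. R_hat M (t + s)) has_fps_expansion A"
proof -
  obtain z where z: "z \<notin> S" "G M z = - t" using D_hat_cases [OF assms] .
  obtain B where B: "(\<lambda>s. G_inv M (G M z + s)) has_fps_expansion B"
    using G_inv_has_fps_expansion [OF z(1)] .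
  have t: "(\<lambda>s. t + s) has_fps_expansion (fps_const t + fps_X)"
    by (intro has_fps_expansion_add has_fps_expansion_const has_fps_expansion_fps_X)
  have "(\<lambda>s. G_inv M (- (t + s))) has_fps_expansion (B oo (- (fps_const t + fps_X) - fps_const (- t)))"
    using B z(2) has_fps_expansion_minus [OF t]
    by (intro has_fps_expansion_compose_at) simp_all
  moreover have "(\<lambda>s. inverse (t + s)) has_fps_expansion inverse (fps_const t + fps_X)"
    using assms(2) by (intro has_fps_expansion_inverse t) simp
  ultimately have "(\<lambda>s. G_inv M (- (t + s)) - inverse (t + s)) has_fps_expansion
      ((B oo (- (fps_const t + fps_X) - fps_const (- t))) - inverse (fps_const t + fps_X))"
    by (rule has_fps_expansion_diff)
  then show ?thesis by (auto simp: R_hat_def divide_inverse)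
qed

text \<open>In the coordinate \<open>w = 1 / z\<close>, the point at infinity becomes a regular point of \<open>G\<close> with
  derivative \<open>-1\<close>, so the singularity of \<open>R_hat M\<close> at \<open>0\<close> is removable.\<close>

lemma R_hat_removable_singularity:
  obtains c A where "(\<lambda>t. if t = 0 then c else R_hat M t) has_fps_expansion A"
proof -
  \<comment> \<open>For small non-zero \<open>w\<close> this is \<open>- G M (1 / w)\<close>; the
    formula extends through \<open>w = 0\<close> with derivative 1.\<close>
  define \<phi> where "\<phi> w = w * (\<integral>x. 1 / (1 - x * w) \<partial>M)" for w
  define K where "K = \<bar>supp_minus M\<bar> + \<bar>supp_plus M\<bar> + 1"
  have K: "K > 0" by (simp add: K_def)
  have "AE x in M. \<bar>x\<bar> \<le> K" using AE_S by eventually_elim (auto simp: K_def)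
  then have "(\<lambda>w. \<integral>x. 1 / (1 - x * w) \<partial>M) has_fps_expansion Abs_fps (\<lambda>n. \<integral>x. 1 * x ^ n \<partial>M)"
    by (intro has_fps_expansion_integral_geometric [where B = 1] prob_space_axioms) auto
  then have "\<phi> has_fps_expansion (fps_X * Abs_fps (\<lambda>n. \<integral>x. 1 * x ^ n \<partial>M))"
    unfolding \<phi>_def by (intro has_fps_expansion_mult has_fps_expansion_fps_X)
  then obtain P where P: "\<phi> has_fps_expansion P" "P $ 0 = 0" "P $ 1 = 1"
    using prob_UNIV by (force simp: fps_X_mult_nth)
  have \<phi>0: "\<phi> 0 = 0" by (simp add: \<phi>_def)
  obtain g B where "(\<lambda>t. g (\<phi> 0 + t)) has_fps_expansion B" "g (\<phi> 0) = 0"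
    "eventually (\<lambda>y. \<phi> (g y) = y) (nhds (\<phi> 0))"
    by (rule has_fps_expansion_inverse_function [of \<phi> 0 P]) (use P in simp_all)
  then have g: "g has_fps_expansion B" "g 0 = 0" "eventually (\<lambda>y. \<phi> (g y) = y) (nhds 0)"
    by (simp_all add: \<phi>0)
  have B0: "B $ 0 = 0" using has_fps_expansion_nth_0 [OF g(1)] g(2) by simp
  have "(\<lambda>y. \<phi> (g y)) has_fps_expansion (P oo B)"
    by (rule has_fps_expansion_compose_real [OF P(1) g(1) B0])
  then have "(\<lambda>y. y) has_fps_expansion (P oo B)"
    by (rule has_fps_expansion_transfer [OF g(3)])
  then have "P oo B = fps_X" using has_fps_expansion_unique has_fps_expansion_fps_X by blast
  then have "(P oo B) $ 1 = 1" by simp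
  then have B1: "B $ 1 = 1" using P(3) B0 by (simp add: fps_compose_nth_split)
  then have "B \<noteq> 0" by auto
  then have subdeg: "1 \<le> subdegree B" using B0 by (intro subdegree_geI) auto
  \<comment> \<open>With \<open>g\<close> the local inverse of \<open>\<phi>\<close>,
    \<open>R_hat M t = 1 / g t - 1 / t\<close> is the quotient of \<open>t / g t - 1\<close> by
    \<open>t\<close>. Its numerator is analytic with value 0 at 0, so two shifts remove the
    singularity.\<close>
  define U where "U = fps_shift 1 B"
  have U: "(\<lambda>t. if t = 0 then 1 else g t / t ^ 1) has_fps_expansion U"
    unfolding U_def using B1 by (intro has_fps_expansion_shift g(1) subdeg) simp
  have U0: "U $ 0 = 1" using B1 by (simp add: U_def)
  have V: "(\<lambda>t. inverse (if t = 0 then 1 else g t / t ^ 1) - 1) has_fps_expansion (inverse U - 1)"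
    using U0 by (intro has_fps_expansion_diff has_fps_expansion_inverse U has_fps_expansion_1) auto
  define c where "c = (inverse U - 1) $ 1"
  have W: "(\<lambda>t. if t = 0 then c else (inverse (if t = 0 then 1 else g t / t ^ 1) - 1) / t ^ 1)
      has_fps_expansion fps_shift 1 (inverse U - 1)"
  proof (cases "inverse U - 1 = 0")
    \<comment> \<open>The zero series has subdegree 0 by convention, so the shift rule does not
      apply. This happens, for example, for the Dirac mass at 0.\<close>
    case True
    have "eventually (\<lambda>t. (0::real) = (if t = 0 then c else (inverse (if t = 0 then 1 else g t / t ^ 1) - 1) / t ^ 1)) (nhds 0)"
    proof -
      have "eventually (\<lambda>t. inverse (if t = 0 then 1 else g t / t ^ 1) - 1 = 0) (nhds 0)"
        using V unfolding True by (simp add: has_fps_expansion_0_iff)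
      then show ?thesis by eventually_elim (use True in \<open>auto simp: c_def\<close>)
    qed
    moreover have "(\<lambda>_. 0) has_fps_expansion fps_shift 1 (inverse U - 1)" unfolding True by simp
    ultimately show ?thesis by (rule has_fps_expansion_transfer)
  next
    case False
    then have "1 \<le> subdegree (inverse U - 1)" using U0 by (intro subdegree_geI) auto
    then show ?thesis by (intro has_fps_expansion_shift V) (auto simp: c_def)
  qed
  have "(g \<longlongrightarrow> 0) (nhds 0)"
    using has_fps_expansion_imp_continuous [OF g(1), of UNIV] g(2) by (metis continuous_at tendsto_nhds_iff)
  then have "eventually (\<lambda>t. \<bar>g t\<bar> < 1 / K) (nhds 0)"
    using K tendstoD [of g 0 "nhds 0" "1 / K"] by (simp add: dist_real_def)
  with g(3) have "eventually (\<lambda>t. (if t = 0 then c else (inverse (if t = 0 then 1 else g t / t ^ 1) - 1) / t ^ 1)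
      = (if t = 0 then c else R_hat M t)) (nhds 0)"
  proof eventually_elim
    case (elim t)
    show ?case
    proof (cases "t = 0")
      case False
      have w: "g t \<noteq> 0" using elim(1) False \<phi>0 by auto
      have "1 / \<bar>g t\<bar> > K" using elim(2) w K by (simp add: field_simps)
      then have "\<bar>1 / g t\<bar> > K" by simp
      then have z: "1 / g t \<notin> S" unfolding K_def by (auto simp: abs_if split: if_splits)
      have "G M (1 / g t) = (\<integral>x. - (g t * (1 / (1 - x * g t))) \<partial>M)"
        unfolding G_def using w by (intro Bochner_Integration.integral_cong refl) (auto simp: divide_simps algebra_simps)
      also have "\<dots> = - \<phi> (g t)"
        unfolding \<phi>_def by (simp only: Bochner_Integration.integral_minus integral_mult_right_zero)
      finally have "G M (1 / g t) = - t" using elim(1) by simp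
      then have "G_inv M (- t) = 1 / g t" using G_inv_G [OF z] by simp
      then show ?thesis using False w by (simp add: R_hat_def field_simps)
    qed simp
  qed
  from has_fps_expansion_transfer [OF this W] show ?thesis by (rule that)
qed

section \<open>Gluing analytic extensions of \<open>R_hat\<close>\<close>

lemma R_extension_D_hat: "\<exists>f. R_extension M (D_hat M) f"
proof -
  obtain c A where A: "(\<lambda>t. if t = 0 then c else R_hat M t) has_fps_expansion A"
    using R_hat_removable_singularity by blast
  define f where "f t = (if t = 0 then c else R_hat M t)" for t
  have "\<exists>A. (\<lambda>s. f (t + s)) has_fps_expansion A" if t: "t \<in> D_hat M" for t
  proof (cases "t = 0")
    case True
    then show ?thesis using A by (auto simp: f_def)
  next
    case False
    obtain B where B: "(\<lambda>s. R_hat M (t + s)) has_fps_expansion B"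
      using R_hat_has_fps_expansion [OF t False] by blast
    have "eventually (\<lambda>y. y \<in> - {0}) (nhds t)"
      using False by (intro eventually_nhds_in_open) auto
    then have "eventually (\<lambda>y. R_hat M y = f y) (nhds t)" by eventually_elim (simp add: f_def)
    from has_fps_expansion_at_cong [OF this B] show ?thesis by blast
  qed
  then have "R_extension M (D_hat M) f"
    by (simp add: R_extension_def open_D_hat is_interval_D_hat real_analytic_on_def f_def)
  then show ?thesis by blast
qed

text \<open>The identity theorem on the connected set \<open>K\<close>: local agreement is an open
  condition, isolated zeros make its failure open as well, and both functions equal
  \<open>R_hat M\<close> on \<open>D_hat M - {0}\<close>.\<close>

lemma R_extension_unique:
  assumes f: "R_extension M I f" and g: "R_extension M J g" and x: "x \<in> I" "x \<in> J"
  shows "f x = g x"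
proof -
  define K where "K = I \<inter> J"
  define Z where "Z = {x \<in> K. eventually (\<lambda>y. f y = g y) (nhds x)}"
  have "open K" "is_interval K" "D_hat M \<subseteq> K"
    using f g by (auto simp: R_extension_def K_def intro: is_interval_Int)
  then have K: "open K" "connected K" "D_hat M \<subseteq> K" by (auto simp: is_interval_connected)
  have "open Z"
  proof (subst open_subopen, intro ballI)
    fix x assume x: "x \<in> Z"
    then obtain U where U: "open U" "x \<in> U" "\<And>y. y \<in> U \<Longrightarrow> f y = g y"
      unfolding Z_def eventually_nhds by blast
    have "eventually (\<lambda>y. f y = g y) (nhds y)" if "y \<in> U" for y
      using U that unfolding eventually_nhds by blast
    then have "U \<inter> K \<subseteq> Z" by (auto simp: Z_def)
    then show "\<exists>T. open T \<and> x \<in> T \<and> T \<subseteq> Z" using U K(1) x by (intro exI[of _ "U \<inter> K"]) (auto simp: Z_def)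
  qed
  moreover have "open (K - Z)"
  proof (subst open_subopen, intro ballI)
    fix x assume x: "x \<in> K - Z"
    obtain A where A: "(\<lambda>t. f (x + t)) has_fps_expansion A"
      using f x by (auto simp: R_extension_def real_analytic_on_def K_def)
    obtain B where B: "(\<lambda>t. g (x + t)) has_fps_expansion B"
      using g x by (auto simp: R_extension_def real_analytic_on_def K_def)
    have D: "(\<lambda>t. f (x + t) - g (x + t)) has_fps_expansion A - B"
      by (rule has_fps_expansion_diff [OF A B])
    have lim: "((\<lambda>y. y - x) \<longlongrightarrow> 0) (nhds x)"
      by (rule tendsto_eq_intros filterlim_ident refl)+ simp
    have "A - B \<noteq> 0"
    proof
      assume "A - B = 0"
      then have "eventually (\<lambda>t. f (x + t) - g (x + t) = 0) (nhds 0)"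
        using D by (simp add: has_fps_expansion_0_iff)
      from eventually_compose_filterlim [OF this lim] have "eventually (\<lambda>y. f y = g y) (nhds x)"
        by simp
      then show False using x by (simp add: Z_def)
    qed
    with D have "eventually (\<lambda>t. f (x + t) - g (x + t) \<noteq> 0) (at 0)"
      by (intro has_fps_expansion_eventually_nonzero)
    then have "eventually (\<lambda>t. t \<noteq> 0 \<longrightarrow> f (x + t) - g (x + t) \<noteq> 0) (nhds 0)"
      by (simp add: eventually_at_filter)
    from eventually_compose_filterlim [OF this lim]
    have "eventually (\<lambda>y. y \<noteq> x \<longrightarrow> f y \<noteq> g y) (nhds x)" by simp
    then obtain U where U: "open U" "x \<in> U" "\<And>y. y \<in> U \<Longrightarrow> y \<noteq> x \<Longrightarrow> f y \<noteq> g y"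
      unfolding eventually_nhds by blast
    have "U \<inter> K \<subseteq> K - Z"
    proof
      fix y assume y: "y \<in> U \<inter> K"
      show "y \<in> K - Z"
      proof (cases "y = x")
        case False
        then have "f y \<noteq> g y" using U(3) y by auto
        then show ?thesis using y by (auto simp: Z_def dest: eventually_nhds_x_imp_x)
      qed (use x in simp)
    qed
    then show "\<exists>T. open T \<and> x \<in> T \<and> T \<subseteq> K - Z" using U K(1) x by (intro exI[of _ "U \<inter> K"]) auto
  qed
  moreover have "Z \<noteq> {}"
  proof -
    have "open (D_hat M - {0})" by (intro open_Diff open_D_hat) simp
    moreover have "infinite (D_hat M)"
      using open_D_hat zero_in_D_hat by (metis empty_iff finite_imp_not_open)
    then have "D_hat M - {0} \<noteq> {}" by (metis finite.emptyI finite_insert finite_Diff2)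
    then obtain t where t: "t \<in> D_hat M - {0}" by blast
    ultimately have "eventually (\<lambda>y. y \<in> D_hat M - {0}) (nhds t)"
      by (intro eventually_nhds_in_open)
    then have "eventually (\<lambda>y. f y = g y) (nhds t)"
      by eventually_elim (use f g in \<open>simp add: R_extension_def\<close>)
    then show ?thesis using t K(3) by (auto simp: Z_def)
  qed
  ultimately have "K - Z = {}"
    using connectedD [OF K(2), of Z "K - Z"] by (auto simp: Z_def)
  then have "x \<in> Z" using x by (auto simp: K_def)
  then show ?thesis by (auto simp: Z_def dest: eventually_nhds_x_imp_x)
qed

text \<open>\<open>R_transform\<close> is a choice, so an extension on all of
  \<open>R_domain M\<close> must exist. Local extensions agree on overlaps and glue together; the
  union is an interval because all the pieces contain 0.\<close>

lemma R_extension_R_transform: "R_extension M (R_domain M) (R_transform M)"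
proof -
  define I f where "I x = (SOME I. \<exists>f. R_extension M I f \<and> x \<in> I)"
    and "f x = (SOME f. R_extension M (I x) f) x" for x :: real
  have f: "f x = g x" if g: "R_extension M J g" "x \<in> J" for J g x
  proof -
    have "\<exists>f. R_extension M (I x) f \<and> x \<in> I x" unfolding I_def by (rule someI_ex) (use g in blast)
    then obtain h where h: "R_extension M (I x) h" "x \<in> I x" by blast
    have "R_extension M (I x) (SOME f. R_extension M (I x) f)" by (rule someI [of "R_extension M (I x)", OF h(1)])
    from R_extension_unique [OF this g(1) h(2) g(2)] show ?thesis by (simp add: f_def)
  qed
  have "R_extension M (R_domain M) f"
    unfolding R_extension_def
  proof (intro conjI ballI)
    show "open (R_domain M)" unfolding R_domain_def by (auto simp: R_extension_def)
    show "is_interval (R_domain M)"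
      unfolding is_interval_connected_1 R_domain_def
    proof (rule connected_Union)
      show "connected J" if "J \<in> {I. \<exists>f. R_extension M I f}" for J
        using that by (auto simp: R_extension_def is_interval_connected)
      show "\<Inter> {I. \<exists>f. R_extension M I f} \<noteq> {}"
        using zero_in_D_hat by (auto simp: R_extension_def)
    qed
    show D: "D_hat M \<subseteq> R_domain M" using R_extension_D_hat by (auto simp: R_domain_def)
    show "real_analytic_on f (R_domain M)"
      unfolding real_analytic_on_def
    proof
      fix x assume "x \<in> R_domain M"
      then obtain J g where g: "R_extension M J g" "x \<in> J" by (auto simp: R_domain_def)
      then obtain A where A: "(\<lambda>t. g (x + t)) has_fps_expansion A"
        by (auto simp: R_extension_def real_analytic_on_def)
      have "eventually (\<lambda>y. y \<in> J) (nhds x)"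
        using g by (intro eventually_nhds_in_open) (auto simp: R_extension_def)
      then have "eventually (\<lambda>y. g y = f y) (nhds x)"
        by eventually_elim (use f [OF g(1)] in simp)
      from has_fps_expansion_at_cong [OF this A] show "\<exists>A. (\<lambda>t. f (x + t)) has_fps_expansion A" by blast
    qed
    fix t assume t: "t \<in> D_hat M - {0}"
    then obtain J g where g: "R_extension M J g" "t \<in> J" using D by (auto simp: R_domain_def)
    then show "f t = R_hat M t" using f [OF g] t by (simp add: R_extension_def)
  qed
  then show ?thesis
    unfolding R_transform_def by (rule someI [of "R_extension M (R_domain M)"])
qed

lemma D_hat_subset_R_domain: "D_hat M \<subseteq> R_domain M"
  and open_R_domain: "open (R_domain M)"
  and is_interval_R_domain: "is_interval (R_domain M)"
  and R_transform_analytic: "t \<in> R_domain M \<Longrightarrow> \<exists>A. (\<lambda>s. R_transform M (t + s)) has_fps_expansion A"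
  using R_extension_R_transform by (auto simp: R_extension_def real_analytic_on_def)

lemma R_transform_eq:
  assumes "0 < g" "ereal g < G_minus M"
  shows "R_transform M (- g) = G_inv M g + 1 / g"
  using R_extension_R_transform minus_in_D_hat [OF assms] assms(1)
  by (auto simp: R_extension_def R_hat_def)

end

section \<open>Subordination\<close>

text \<open>The function is the reciprocal Cauchy transform (in the usual sign convention) minus the
  identity. Kaluza's theorem covers degrees from two on; in degree one the extra -1 is compensated
  by \<open>G_squared_le\<close>.\<close>

lemma (in compact_distribution) reciprocal_has_fps_expansion:
  assumes u: "u < supp_minus M"
  obtains A where "(\<lambda>s. - (u + s) - 1 / G M (u + s)) has_fps_expansion A" "\<And>n. n \<ge> 1 \<Longrightarrow> A $ n \<ge> 0"
proof -
  let ?C = "cauchy_fps M u"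
  define A where "A = - (fps_const u + fps_X) - inverse ?C"
  have C0: "?C $ 0 > 0" by (rule cauchy_fps_pos [OF u])
  have "u \<notin> S" using u by auto
  then have "(\<lambda>s. - (u + s) - inverse (G M (u + s))) has_fps_expansion A"
    unfolding A_def using C0
    by (intro has_fps_expansion_diff has_fps_expansion_minus has_fps_expansion_add has_fps_expansion_inverse
        has_fps_expansion_const has_fps_expansion_fps_X G_has_fps_expansion) auto
  moreover have "A $ n \<ge> 0" if n: "n \<ge> 1" for n
  proof (cases "n = 1")
    case True
    have "(?C * inverse ?C) $ 1 = 0" using C0 by (simp add: inverse_mult_eq_1')
    then have "?C $ 0 * inverse ?C $ 1 + ?C $ 1 * inverse ?C $ 0 = 0"
      by (simp add: fps_mult_nth)
    then have "inverse ?C $ 1 = - (?C $ 1 / (?C $ 0)\<^sup>2)"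
      using C0 by (simp add: field_simps power2_eq_square)
    moreover have "1 \<le> ?C $ 1 / (?C $ 0)\<^sup>2"
      using G_squared_le [OF u] C0 by (simp add: G_eq_nth)
    ultimately show ?thesis using True by (simp add: A_def)
  next
    case False
    then show ?thesis using inverse_cauchy_fps_nonpos [OF u n] n by (simp add: A_def)
  qed
  ultimately show ?thesis by (intro that [of A]) (simp_all add: divide_inverse)
qed

locale three_distributions =
  M: compact_distribution M + N: compact_distribution N + K: compact_distribution K
  for M N K :: "real measure"
begin

text \<open>Here \<open>h\<close> and \<open>k\<close> are the restrictions to the real line of the subordination functions of
  the free convolution. The kernel coefficients of \<open>N\<close> are dominated by those of \<open>K\<close> because
  \<open>h\<close> and \<open>k\<close> have non-negative Taylor coefficients, and \<open>h' \<ge> 1\<close>.\<close>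

lemma cauchy_fps_subordination:
  fixes h k :: "real \<Rightarrow> real"
  assumes z: "z < L" "L \<le> supp_minus K"
    and h: "\<And>w. w < L \<Longrightarrow> h w < supp_minus N \<and> G N (h w) = G K w"
    and k: "\<And>w. w < L \<Longrightarrow> k w < supp_minus M \<and> G M (k w) = G K w"
    and hk: "\<And>w. w < L \<Longrightarrow> w = h w + k w + 1 / G K w"
  shows "cauchy_fps N (h z) $ n \<le> cauchy_fps K z $ n"
proof -
  have zS: "z \<notin> K.S" using z by auto
  have ev: "eventually (\<lambda>w. w < L) (nhds z)"
    using z(1) eventually_nhds_in_open [of "{..<L}" z] by simp
  have GK: "(\<lambda>t. G K (z + t)) has_fps_expansion cauchy_fps K z"
    by (rule K.G_has_fps_expansion [OF zS])
  have hS: "h z \<notin> N.S" and kS: "k z \<notin> M.S" using h [OF z(1)] k [OF z(1)] by auto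
  \<comment> \<open>Only values of \<open>h\<close> and \<open>k\<close> are given; their
    analyticity comes from writing them as compositions with \<open>G_inv\<close>.\<close>
  have hG: "G_inv N (G K w) = h w" and kG: "G_inv M (G K w) = k w" if "w < L" for w
    using N.G_inv_G [of "h w"] M.G_inv_G [of "k w"] h [OF that] k [OF that] by auto
  obtain B where "(\<lambda>t. G_inv N (G N (h z) + t)) has_fps_expansion B"
    using N.G_inv_has_fps_expansion [OF hS] .
  then have "(\<lambda>t. G_inv N (G K z + t)) has_fps_expansion B" using h [OF z(1)] by simp
  from has_fps_expansion_compose_at [OF this GK]
  obtain H' where "(\<lambda>t. G_inv N (G K (z + t))) has_fps_expansion H'" by blast
  moreover have "eventually (\<lambda>w. G_inv N (G K w) = h w) (nhds z)"
    using ev by eventually_elim (rule hG)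
  ultimately have H': "(\<lambda>t. h (z + t)) has_fps_expansion H'"
    using has_fps_expansion_at_cong [of "\<lambda>w. G_inv N (G K w)" h z] by blast
  obtain C where "(\<lambda>t. G_inv M (G M (k z) + t)) has_fps_expansion C"
    using M.G_inv_has_fps_expansion [OF kS] .
  then have "(\<lambda>t. G_inv M (G K z + t)) has_fps_expansion C" using k [OF z(1)] by simp
  from has_fps_expansion_compose_at [OF this GK]
  obtain K' where "(\<lambda>t. G_inv M (G K (z + t))) has_fps_expansion K'" by blast
  moreover have "eventually (\<lambda>w. G_inv M (G K w) = k w) (nhds z)"
    using ev by eventually_elim (rule kG)
  ultimately have K': "(\<lambda>t. k (z + t)) has_fps_expansion K'"
    using has_fps_expansion_at_cong [of "\<lambda>w. G_inv M (G K w)" k z] by blast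
  define Hf Kf where "Hf = H' - fps_const (h z)" and "Kf = K' - fps_const (k z)"
  have H0: "Hf $ 0 = 0" and K0: "Kf $ 0 = 0"
    using has_fps_expansion_nth_0 [OF H'] has_fps_expansion_nth_0 [OF K'] by (simp_all add: Hf_def Kf_def)
  have "(\<lambda>t. G N (h (z + t))) has_fps_expansion (cauchy_fps N (h z) oo Hf)"
    unfolding Hf_def by (rule has_fps_expansion_compose_at [OF N.G_has_fps_expansion [OF hS] H'])
  moreover have "eventually (\<lambda>w. G N (h w) = G K w) (nhds z)"
    using ev by eventually_elim (simp add: h)
  ultimately have NH: "cauchy_fps N (h z) oo Hf = cauchy_fps K z"
    using has_fps_expansion_at_cong [of "\<lambda>w. G N (h w)" "G K" z] has_fps_expansion_unique [OF _ GK] by blast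
  have "(\<lambda>t. G M (k (z + t))) has_fps_expansion (cauchy_fps M (k z) oo Kf)"
    unfolding Kf_def by (rule has_fps_expansion_compose_at [OF M.G_has_fps_expansion [OF kS] K'])
  moreover have "eventually (\<lambda>w. G M (k w) = G K w) (nhds z)"
    using ev by eventually_elim (simp add: k)
  ultimately have MK: "cauchy_fps M (k z) oo Kf = cauchy_fps K z"
    using has_fps_expansion_at_cong [of "\<lambda>w. G M (k w)" "G K" z] has_fps_expansion_unique [OF _ GK] by blast
  have "cauchy_fps N (h z) $ 1 * Hf $ 1 = cauchy_fps K z $ 1"
    using arg_cong [OF NH, of "\<lambda>F. F $ 1"] H0 by (simp add: fps_compose_nth_split)
  then have H1: "Hf $ 1 > 0"
    using K.cauchy_fps_1_pos [OF zS] N.cauchy_fps_1_pos [OF hS] by (metis zero_less_mult_pos)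
  have "cauchy_fps M (k z) $ 1 * Kf $ 1 = cauchy_fps K z $ 1"
    using arg_cong [OF MK, of "\<lambda>F. F $ 1"] K0 by (simp add: fps_compose_nth_split)
  then have K1: "Kf $ 1 > 0"
    using K.cauchy_fps_1_pos [OF zS] M.cauchy_fps_1_pos [OF kS] by (metis zero_less_mult_pos)
  \<comment> \<open>Replacing \<open>G K w\<close> by \<open>G M (k w)\<close> in the relation
    \<open>hk\<close> expresses \<open>h\<close> through \<open>k\<close>; replacing it by
    \<open>G N (h w)\<close> expresses \<open>k\<close> through \<open>h\<close>. In degrees from
    one on these are the coupled equations.\<close>
  obtain A where A: "(\<lambda>s. - (k z + s) - 1 / G M (k z + s)) has_fps_expansion A" "\<And>n. n \<ge> 1 \<Longrightarrow> A $ n \<ge> 0"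
    using M.reciprocal_has_fps_expansion k [OF z(1)] by metis
  obtain B where B: "(\<lambda>s. - (h z + s) - 1 / G N (h z + s)) has_fps_expansion B" "\<And>n. n \<ge> 1 \<Longrightarrow> B $ n \<ge> 0"
    using N.reciprocal_has_fps_expansion h [OF z(1)] by metis
  have id: "(\<lambda>t. z + t) has_fps_expansion (fps_const z + fps_X)"
    by (intro has_fps_expansion_add has_fps_expansion_const has_fps_expansion_fps_X)
  have "(\<lambda>t. - k (z + t) - 1 / G M (k (z + t))) has_fps_expansion (A oo Kf)"
    unfolding Kf_def by (rule has_fps_expansion_compose_at [where f = "\<lambda>u. - u - 1 / G M u", OF A(1) K'])
  from has_fps_expansion_add [OF id this]
  have "(\<lambda>t. (z + t) + (- k (z + t) - 1 / G M (k (z + t)))) has_fps_expansion (fps_const z + fps_X + (A oo Kf))" .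
  moreover have "eventually (\<lambda>w. w + (- k w - 1 / G M (k w)) = h w) (nhds z)"
    using ev by eventually_elim (use hk k in \<open>simp add: algebra_simps\<close>)
  ultimately have "H' = fps_const z + fps_X + (A oo Kf)"
    using has_fps_expansion_at_cong [of "\<lambda>w. w + (- k w - 1 / G M (k w))" h z] has_fps_expansion_unique [OF H'] by blast
  then have Hn: "Hf $ n = fps_X $ n + (A oo Kf) $ n" if "n \<ge> 1" for n
    using that by (simp add: Hf_def)
  have "(\<lambda>t. - h (z + t) - 1 / G N (h (z + t))) has_fps_expansion (B oo Hf)"
    unfolding Hf_def by (rule has_fps_expansion_compose_at [where f = "\<lambda>u. - u - 1 / G N u", OF B(1) H'])
  from has_fps_expansion_add [OF id this]
  have "(\<lambda>t. (z + t) + (- h (z + t) - 1 / G N (h (z + t)))) has_fps_expansion (fps_const z + fps_X + (B oo Hf))" .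
  moreover have "eventually (\<lambda>w. w + (- h w - 1 / G N (h w)) = k w) (nhds z)"
    using ev by eventually_elim (use hk h in \<open>simp add: algebra_simps\<close>)
  ultimately have "K' = fps_const z + fps_X + (B oo Hf)"
    using has_fps_expansion_at_cong [of "\<lambda>w. w + (- h w - 1 / G N (h w))" k z] has_fps_expansion_unique [OF K'] by blast
  then have Kn: "Kf $ n = fps_X $ n + (B oo Hf) $ n" if "n \<ge> 1" for n
    using that by (simp add: Kf_def)
  have nn: "Hf $ n \<ge> 0" for n
    using coupled_fps_nonneg [OF H0 K0 H1 K1 A(2) B(2) Hn Kn] by blast
  have "Hf $ 1 = 1 + A $ 1 * Kf $ 1" using Hn [of 1] K0 by (simp add: fps_compose_nth_split)
  then have "Hf $ 1 \<ge> 1" using A(2) [of 1] K1 by simp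
  then have "cauchy_fps N (h z) $ n * 1 \<le> cauchy_fps N (h z) $ n * (Hf $ 1) ^ n"
    using N.cauchy_fps_pos h [OF z(1)] by (intro mult_left_mono one_le_power) (auto intro: less_imp_le)
  also have "\<dots> \<le> (cauchy_fps N (h z) oo Hf) $ n"
    using N.cauchy_fps_pos h [OF z(1)] H0 nn by (intro fps_compose_nth_ge) (auto intro: less_imp_le)
  finally show ?thesis by (simp add: NH)
qed

text \<open>The assumption on \<open>G_minus M\<close> makes \<open>k\<close> available wherever
  \<open>h\<close> is. If \<open>G K\<close> passed \<open>g\<close>, it would stay analytic up to a
  distance \<open>d\<close> beyond \<open>L\<close>; subordination hands this surplus to
  \<open>N\<close>, whose support leaves no room for it.\<close>

lemma G_minus_le_if_le_other:
  assumes g: "0 < g" "G_minus N = ereal g" "ereal g \<le> G_minus M"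
    and eq: "\<And>g'. 0 < g' \<Longrightarrow> g' < g \<Longrightarrow> ereal g' < G_minus K \<Longrightarrow> G_inv K g' = G_inv M g' + G_inv N g' + 1 / g'"
  shows "G_minus K \<le> G_minus N"
proof (rule ccontr)
  assume "\<not> G_minus K \<le> G_minus N"
  then have lt: "ereal g < G_minus K" using g(2) by simp
  define L where "L = G_inv K g"
  have L: "L < supp_minus K" "G K L = g" using K.G_inv_props [OF g(1) lt] by (auto simp: L_def)
  define d where "d = supp_minus K - L"
  have d: "d > 0" using L by (simp add: d_def)
  define h k where "h w = G_inv N (G K w)" and "k w = G_inv M (G K w)" for w
  have GK: "0 < G K w" "ereal (G K w) < ereal g" if "w < L" for w
    using K.G_pos [of w] K.G_strict_mono_left [of w L] L that by auto
  have h: "h w < supp_minus N \<and> G N (h w) = G K w" if "w < L" for w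
    using N.G_inv_props [OF GK(1) [OF that]] GK(2) [OF that] g(2) by (simp add: h_def)
  have k: "k w < supp_minus M \<and> G M (k w) = G K w" if "w < L" for w
    using M.G_inv_props [OF GK(1) [OF that] order.strict_trans2 [OF GK(2) [OF that] g(3)]] by (simp add: k_def)
  have hk: "w = h w + k w + 1 / G K w" if "w < L" for w
  proof -
    have "w \<notin> K.S" using that L by auto
    then have "w = G_inv K (G K w)" by (simp add: K.G_inv_G)
    also have "\<dots> = G_inv M (G K w) + G_inv N (G K w) + 1 / G K w"
      using GK [OF that] less_trans [OF GK(2) [OF that] lt] by (intro eq) auto
    finally show ?thesis by (simp add: h_def k_def)
  qed
  \<comment> \<open>Any \<open>u\<close> closer than \<open>d\<close> to the end point would do. Its
    counterpart \<open>z\<close>, with \<open>h z = u\<close>, lies left of \<open>L\<close> and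
    hence farther than \<open>d\<close> from the support of \<open>K\<close>.\<close>
  define u where "u = supp_minus N - d / 2"
  have u: "u < supp_minus N" "supp_minus N < u + d" using d by (auto simp: u_def)
  have Gu: "0 < G N u" "ereal (G N u) < ereal g"
    using N.G_pos [OF u(1)] N.G_less_G_minus [OF u(1)] g(2) by auto
  define z where "z = G_inv K (G N u)"
  have z: "z < supp_minus K" "G K z = G N u"
    using K.G_inv_props [OF Gu(1) less_trans [OF Gu(2) lt]] by (auto simp: z_def)
  have zL: "z < L"
  proof (rule ccontr)
    assume "\<not> z < L"
    then have "G K L \<le> G K z" using K.G_strict_mono_left [of L z] z(1) by (cases "L = z") auto
    then show False using z(2) L(2) Gu(2) by simp
  qed
  have "u \<notin> N.S" using u by auto
  then have hz: "h z = u" using N.G_inv_G [of u] by (simp add: h_def z(2))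
  have "cauchy_fps N u $ n \<le> (1 / d) / d ^ n" for n
  proof -
    have "cauchy_fps N u $ n \<le> cauchy_fps K z $ n"
      using cauchy_fps_subordination [OF zL less_imp_le [OF L(1)] h k hk] hz by simp
    also have "\<dots> \<le> (1 / (supp_minus K - z)) ^ Suc n" by (rule K.cauchy_fps_le [OF z(1)])
    also have "\<dots> \<le> (1 / d) ^ Suc n"
      using d zL L z by (intro power_mono divide_left_mono) (auto simp: d_def)
    finally show ?thesis by (simp add: power_divide)
  qed
  from N.cauchy_fps_radius_contradiction [OF u this] show False .
qed

end

locale free_convolution = three_distributions +
  assumes convolution: "is_free_convolution M N K"
begin

text \<open>Each R-transform at \<open>- g\<close> contributes a term \<open>1 / g\<close>; two on
  the right against one on the left leave a single one.\<close>

lemma G_inv_convolution: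
  assumes "0 < g" "ereal g < G_minus M" "ereal g < G_minus N" "ereal g < G_minus K"
  shows "G_inv K g = G_inv M g + G_inv N g + 1 / g"
proof -
  have "- g \<in> R_domain M \<inter> R_domain N"
    using M.minus_in_D_hat N.minus_in_D_hat M.D_hat_subset_R_domain N.D_hat_subset_R_domain assms by blast
  then have "R_transform K (- g) = R_transform M (- g) + R_transform N (- g)"
    using convolution by (simp add: is_free_convolution_def)
  then show ?thesis
    using M.R_transform_eq N.R_transform_eq K.R_transform_eq assms by simp
qed

text \<open>It suffices to bound by the smaller end value; if that is infinite, both bounds are
  trivial. The interpretation \<open>swap\<close> serves the case where it belongs to
  \<open>M\<close>.\<close>

lemma G_minus_K_le: "G_minus K \<le> G_minus M" "G_minus K \<le> G_minus N"
proof -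
  interpret swap: three_distributions N M K by unfold_locales
  have "G_minus K \<le> G_minus M \<and> G_minus K \<le> G_minus N"
  proof (cases "G_minus N \<le> G_minus M")
    case True
    have "G_minus K \<le> G_minus N"
    proof (cases "G_minus N")
      case (real g)
      show ?thesis
      proof (rule G_minus_le_if_le_other [of g])
        fix g' assume g': "0 < g'" "g' < g" "ereal g' < G_minus K"
        then have "ereal g' < G_minus N" using real by simp
        then show "G_inv K g' = G_inv M g' + G_inv N g' + 1 / g'"
          using g' True by (intro G_inv_convolution) (auto intro: less_le_trans)
      qed (use True real N.G_minus_pos in auto)
    qed (use N.G_minus_pos in auto)
    then show ?thesis using True by simp
  next
    case False
    have "G_minus K \<le> G_minus M"
    proof (cases "G_minus M")
      case (real g)
      show ?thesis
      proof (rule swap.G_minus_le_if_le_other [of g])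
        fix g' assume g': "0 < g'" "g' < g" "ereal g' < G_minus K"
        then have "ereal g' < G_minus M" using real by simp
        then have "G_inv K g' = G_inv M g' + G_inv N g' + 1 / g'"
          using g' False by (intro G_inv_convolution) auto
        then show "G_inv K g' = G_inv N g' + G_inv M g' + 1 / g'" by simp
      qed (use False real M.G_minus_pos in auto)
    qed (use M.G_minus_pos in auto)
    then show ?thesis using False by simp
  qed
  then show "G_minus K \<le> G_minus M" "G_minus K \<le> G_minus N" by auto
qed

end

section \<open>The lower edge of the free convolution\<close>

context free_convolution
begin

text \<open>The point where \<open>G N\<close> reaches \<open>G_minus K\<close>, which will be
  \<open>h_star\<close> for both choices of \<open>D\<close>. Only the first case can involve an
  infinite value: in the second, \<open>G_minus K < G_minus N\<close>, so the conversion to a real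
  is faithful.\<close>

definition h_edge :: real where
  "h_edge = (if G_minus K = G_minus N then supp_minus N else G_inv N (real_of_ereal (G_minus K)))"

lemma G_minus_K_real:
  assumes "G_minus K \<noteq> G_minus N"
  obtains g where "G_minus K = ereal g" "0 < g" "ereal g < G_minus N" "h_edge < supp_minus N" "G N h_edge = g"
proof -
  have lt: "G_minus K < G_minus N" using assms G_minus_K_le(2) by simp
  then obtain g where g: "G_minus K = ereal g"
    using K.G_minus_pos by (cases "G_minus K") auto
  then have "0 < g" "ereal g < G_minus N" using lt K.G_minus_pos by auto
  then show ?thesis using N.G_inv_props [of g] g assms by (intro that) (auto simp: h_edge_def)
qed

lemma h_edge_le: "h_edge \<le> supp_minus N"
proof (cases "G_minus K = G_minus N")
  case True
  then show ?thesis by (simp add: h_edge_def)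
next
  case False
  then show ?thesis using G_minus_K_real by (metis less_imp_le)
qed

lemma less_h_edge_iff:
  assumes "h < supp_minus N"
  shows "h < h_edge \<longleftrightarrow> ereal (G N h) < G_minus K"
proof (cases "G_minus K = G_minus N")
  case True
  then show ?thesis using N.G_less_G_minus [OF assms] assms by (simp add: h_edge_def)
next
  case False
  then obtain g where g: "G_minus K = ereal g" "h_edge < supp_minus N" "G N h_edge = g"
    using G_minus_K_real by metis
  then show ?thesis
    using N.G_strict_mono_left [of h h_edge] N.G_strict_mono_left [of h_edge h] assms
    by (cases rule: linorder_cases [of h h_edge]) auto
qed

lemma G_left_h_edge: "G_left N h_edge = G_minus K"
proof (cases "G_minus K = G_minus N")
  case True
  then show ?thesis by (simp add: h_edge_def G_left_def)
next
  case False
  then show ?thesis using G_minus_K_real by (metis G_left_def less_irrefl)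
qed

lemma tendsto_G_h_edge: "((\<lambda>h. ereal (G N h)) \<longlongrightarrow> G_minus K) (at_left h_edge)"
proof (cases "G_minus K = G_minus N")
  case True
  then show ?thesis using N.tendsto_G_minus by (simp add: h_edge_def)
next
  case False
  then obtain g where g: "G_minus K = ereal g" "h_edge < supp_minus N" "G N h_edge = g"
    using G_minus_K_real by metis
  then have "h_edge \<notin> N.S" by auto
  from N.isCont_G [OF this] have "(G N \<longlongrightarrow> g) (at_left h_edge)"
    using g(3) by (metis filterlim_at_split isCont_def)
  then show ?thesis using g(1) by simp
qed

lemma left_of_h_edge:
  assumes "h < h_edge"
  shows "h < supp_minus N" "0 < G N h" "ereal (G N h) < G_minus K"
    "ereal (G N h) < G_minus M" "ereal (G N h) < G_minus N"
proof -
  show h: "h < supp_minus N" using assms h_edge_le by simp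
  show "0 < G N h" by (rule N.G_pos [OF h])
  show "ereal (G N h) < G_minus K" using less_h_edge_iff [OF h] assms by simp
  then show "ereal (G N h) < G_minus M" "ereal (G N h) < G_minus N"
    using G_minus_K_le by (auto intro: less_le_trans)
qed

section \<open>The function \<open>F\<close> left of \<open>h_edge\<close>\<close>

lemma F_eq:
  assumes "h < h_edge"
  shows "F M N h = G_inv K (G N h)"
proof -
  note * = left_of_h_edge [OF assms]
  have "G_inv N (G N h) = h" using *(1) by (intro N.G_inv_G) auto
  then show ?thesis
    using G_inv_convolution [OF *(2,4,5,3)] M.R_transform_eq [OF *(2,4)] by (simp add: F_def)
qed

lemma F_props:
  assumes "h < h_edge"
  shows "F M N h < supp_minus K" "G K (F M N h) = G N h"
  using K.G_inv_props [OF left_of_h_edge(2,3) [OF assms]] F_eq [OF assms] by auto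

lemma F_mono:
  assumes "h < h'" "h' < h_edge"
  shows "F M N h < F M N h'"
proof (rule ccontr)
  assume "\<not> F M N h < F M N h'"
  then have "G K (F M N h') \<le> G K (F M N h)"
    using K.G_strict_mono_left [of "F M N h'" "F M N h"] F_props(1) [of h] assms
    by (cases "F M N h = F M N h'") auto
  then show False
    using F_props(2) [of h] F_props(2) [of h'] N.G_strict_mono_left [of h h'] left_of_h_edge(1) [OF assms(2)] assms by simp
qed

text \<open>Differentiability follows from \<open>F_eq\<close> by the chain rule, and the sign from
  differentiating \<open>G K (F M N t) = G N t\<close>, where both transforms have positive
  derivative.\<close>

lemma F_derivative_pos:
  assumes "h < h_edge"
  obtains d where "d > 0" "(F M N has_real_derivative d) (at h)"
proof -
  have hS: "h \<notin> N.S" and FS: "F M N h \<notin> K.S"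
    using left_of_h_edge(1) [OF assms] F_props(1) [OF assms] by auto
  have ev: "eventually (\<lambda>t. t < h_edge) (nhds h)"
    using assms eventually_nhds_in_open [of "{..<h_edge}" h] by simp
  obtain B where "(\<lambda>t. G_inv K (G K (F M N h) + t)) has_fps_expansion B"
    using K.G_inv_has_fps_expansion [OF FS] .
  then have "(G_inv K has_real_derivative B $ 1) (at (G N h))"
    using F_props(2) [OF assms] by (intro has_fps_expansion_has_real_derivative) simp
  from DERIV_chain2 [OF this N.DERIV_G [OF hS]]
  have "((\<lambda>t. G_inv K (G N t)) has_real_derivative B $ 1 * cauchy_fps N h $ 1) (at h)" .
  moreover have "eventually (\<lambda>t. G_inv K (G N t) = F M N t) (nhds h)"
    using ev by eventually_elim (simp add: F_eq)
  ultimately have F: "(F M N has_real_derivative B $ 1 * cauchy_fps N h $ 1) (at h)"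
    using DERIV_cong_ev [OF refl _ refl, of "\<lambda>t. G_inv K (G N t)" "F M N"] by blast
  have "((\<lambda>t. G K (F M N t)) has_real_derivative cauchy_fps K (F M N h) $ 1 * (B $ 1 * cauchy_fps N h $ 1)) (at h)"
    by (rule DERIV_chain2 [OF K.DERIV_G [OF FS] F])
  moreover have "eventually (\<lambda>t. G K (F M N t) = G N t) (nhds h)"
    using ev by eventually_elim (simp add: F_props)
  ultimately have "(G N has_real_derivative cauchy_fps K (F M N h) $ 1 * (B $ 1 * cauchy_fps N h $ 1)) (at h)"
    using DERIV_cong_ev [OF refl _ refl, of "\<lambda>t. G K (F M N t)" "G N"] by blast
  then have "cauchy_fps K (F M N h) $ 1 * (B $ 1 * cauchy_fps N h $ 1) = cauchy_fps N h $ 1"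
    using N.DERIV_G [OF hS] DERIV_unique by blast
  then have "B $ 1 * cauchy_fps N h $ 1 > 0"
    using K.cauchy_fps_1_pos [OF FS] N.cauchy_fps_1_pos [OF hS] by (metis zero_less_mult_pos)
  then show ?thesis using F by (rule that)
qed

text \<open>Comparing values of the strictly increasing \<open>G K\<close> instead of inverting it
  at the limit also covers an infinite \<open>G_minus K\<close>.\<close>

lemma tendsto_F_h_edge: "(F M N \<longlongrightarrow> supp_minus K) (at_left h_edge)"
proof -
  have "eventually (\<lambda>h. h \<in> {h_edge - 1<..<h_edge}) (at_left h_edge)" by (rule eventually_at_left_real) simp
  then have ev: "eventually (\<lambda>h. h < h_edge) (at_left h_edge)" by eventually_elim simp
  show ?thesis
  proof (rule order_tendstoI)
    fix a assume a: "a < supp_minus K"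
    have "eventually (\<lambda>h. ereal (G K a) < ereal (G N h)) (at_left h_edge)"
      by (rule order_tendstoD(1) [OF tendsto_G_h_edge K.G_less_G_minus [OF a]])
    with ev show "eventually (\<lambda>h. a < F M N h) (at_left h_edge)"
    proof eventually_elim
      case (elim h)
      then have "G K a < G K (F M N h)" using F_props(2) by simp
      then show ?case using K.G_strict_mono_left [of "F M N h" a] a by (cases rule: linorder_cases [of "F M N h" a]) auto
    qed
  next
    fix a assume "supp_minus K < a"
    show "eventually (\<lambda>h. F M N h < a) (at_left h_edge)"
      using ev by eventually_elim (rule less_trans [OF F_props(1) \<open>supp_minus K < a\<close>])
  qed
qed

section \<open>\<open>F\<close> on an open interval \<open>D\<close> between \<open>D_hat\<close>
  and \<open>R_domain\<close>\<close>

context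
  fixes D :: "real set"
  assumes D: "D_hat M \<subseteq> D" "D \<subseteq> R_domain M" "open D" "is_interval D"
begin

lemma F_dom_iff: "h \<in> F_dom D N \<longleftrightarrow> h < supp_minus N \<and> - G N h \<in> D"
proof -
  have "G N h \<in> uminus ` D" if "- G N h \<in> D" using that by (rule rev_image_eqI) simp
  then show ?thesis by (auto simp: F_dom_def)
qed

lemmas F_dom_below = F_dom_iff [THEN iffD1, THEN conjunct1]
  and F_domI = F_dom_iff [THEN iffD2, OF conjI]

text \<open>Moving left moves \<open>- G N h\<close> towards 0, which belongs to the interval
  \<open>D\<close>.\<close>

lemma F_dom_downward:
  assumes "h \<in> F_dom D N" "h' \<le> h"
  shows "h' \<in> F_dom D N"
proof -
  have h: "h < supp_minus N" "- G N h \<in> D" using assms(1) by (simp_all add: F_dom_iff)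
  have "G N h' \<le> G N h" using N.G_strict_mono_left [of h' h] h assms(2) by (cases "h = h'") auto
  moreover have "0 < G N h'" using N.G_pos h assms(2) by simp
  moreover have "0 \<in> D" using D(1) M.zero_in_D_hat by auto
  ultimately have "- G N h' \<in> D"
    using D(4) [unfolded is_interval_1, rule_format, of "- G N h" 0 "- G N h'"] h(2) by simp
  then show ?thesis using h assms(2) by (intro F_domI) auto
qed

lemma open_F_dom: "open (F_dom D N)"
proof -
  have "continuous_on {..<supp_minus N} (\<lambda>h. - G N h)"
    by (intro continuous_on_minus continuous_at_imp_continuous_on ballI N.isCont_G) auto
  then have "open ({..<supp_minus N} \<inter> (\<lambda>h. - G N h) -` D)"
    using D(3) by (intro continuous_open_preimage) auto
  also have "{..<supp_minus N} \<inter> (\<lambda>h. - G N h) -` D = F_dom D N"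
    by (auto simp: F_dom_iff)
  finally show ?thesis .
qed

lemma lessThan_h_edge_subset_F_dom: "{..<h_edge} \<subseteq> F_dom D N"
proof
  fix h assume "h \<in> {..<h_edge}"
  then have h: "h < h_edge" by simp
  show "h \<in> F_dom D N"
    using left_of_h_edge [OF h] M.minus_in_D_hat [of "G N h"] D(1) by (intro F_domI) auto
qed

lemma F_dom_eq_lessThan: "\<exists>h_max. F_dom D N = {..<h_max}"
proof (intro exI set_eqI iffI)
  have bdd: "bdd_above (F_dom D N)" by (rule bdd_aboveI [of _ "supp_minus N"]) (simp add: F_dom_iff)
  have ne: "F_dom D N \<noteq> {}" using lessThan_h_edge_subset_F_dom by auto
  fix h
  show "h \<in> {..<Sup (F_dom D N)}" if h: "h \<in> F_dom D N"
  proof -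
    obtain e where "e > 0" "ball h e \<subseteq> F_dom D N" using open_F_dom h by (auto simp: open_contains_ball)
    then have "h + e / 2 \<in> F_dom D N" by (auto simp: subset_iff dist_real_def)
    then have "h + e / 2 \<le> Sup (F_dom D N)" by (rule cSup_upper [OF _ bdd])
    then show ?thesis using \<open>e > 0\<close> by simp
  qed
  show "h \<in> F_dom D N" if h: "h \<in> {..<Sup (F_dom D N)}"
  proof -
    obtain h' where "h' \<in> F_dom D N" "h < h'" using h less_cSup_iff [OF ne bdd, of h] by auto
    then show ?thesis by (intro F_dom_downward [of h' h]) simp_all
  qed
qed

lemma F_has_fps_expansion:
  assumes "h \<in> F_dom D N"
  obtains A where "(\<lambda>t. F M N (h + t)) has_fps_expansion A"
proof -
  have h: "h \<notin> N.S" "- G N h \<in> R_domain M" using D(2) assms by (auto simp: F_dom_iff)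
  obtain A where A: "(\<lambda>s. R_transform M (- G N h + s)) has_fps_expansion A"
    using M.R_transform_analytic [OF h(2)] by blast
  have "(\<lambda>t. R_transform M (- G N (h + t))) has_fps_expansion (A oo (- cauchy_fps N h - fps_const (- G N h)))"
    by (rule has_fps_expansion_compose_at [where g = "\<lambda>h. - G N h", OF A
        has_fps_expansion_minus [OF N.G_has_fps_expansion [OF h(1)]]])
  moreover have "(\<lambda>t. h + t) has_fps_expansion (fps_const h + fps_X)"
    by (intro has_fps_expansion_add has_fps_expansion_const has_fps_expansion_fps_X)
  ultimately have "(\<lambda>t. F M N (h + t)) has_fps_expansion
      ((A oo (- cauchy_fps N h - fps_const (- G N h))) + (fps_const h + fps_X))"
    unfolding F_def by (rule has_fps_expansion_add)
  then show ?thesis by (rule that)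
qed

lemma F_h_edge: "h_edge \<in> F_dom D N \<Longrightarrow> F M N h_edge = supp_minus K"
proof -
  assume h_edge: "h_edge \<in> F_dom D N"
  obtain A where "(\<lambda>t. F M N (h_edge + t)) has_fps_expansion A" using F_has_fps_expansion [OF h_edge] .
  then have "isCont (F M N) h_edge" using has_fps_expansion_has_real_derivative DERIV_isCont by blast
  then have "(F M N \<longlongrightarrow> F M N h_edge) (at_left h_edge)" by (metis filterlim_at_split isCont_def)
  then show ?thesis using tendsto_F_h_edge tendsto_unique trivial_limit_at_left_real by blast
qed

text \<open>A positive derivative at \<open>h_edge\<close> would make \<open>G K\<close> continue analytically across the lower end
  point of its support, as the composition of \<open>G N\<close> with the local inverse of \<open>F M N\<close>.\<close>

lemma F_derivative_h_edge:
  assumes h_edge: "h_edge \<in> F_dom D N" and d: "(F M N has_real_derivative d) (at h_edge)" "d > 0"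
  shows False
proof -
  obtain A where A: "(\<lambda>t. F M N (h_edge + t)) has_fps_expansion A" using F_has_fps_expansion [OF h_edge] .
  have "A $ 1 = d" using has_fps_expansion_has_real_derivative [OF A] d(1) DERIV_unique by blast
  then have A1: "A $ 1 \<noteq> 0" using d(2) by simp
  obtain g B where g: "(\<lambda>t. g (F M N h_edge + t)) has_fps_expansion B" "g (F M N h_edge) = h_edge"
    "eventually (\<lambda>t. g (F M N t) = t) (nhds h_edge)"
    using has_fps_expansion_inverse_function [OF A A1] .
  have "h_edge \<notin> N.S" using F_dom_below [OF h_edge] by auto
  from N.G_has_fps_expansion [OF this] g(1,2)
  obtain C where C: "(\<lambda>t. G N (g (supp_minus K + t))) has_fps_expansion C"
    using has_fps_expansion_compose_at [of "G N" g "F M N h_edge" "cauchy_fps N h_edge" B] F_h_edge [OF h_edge] by auto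
  obtain r c where r: "r > 0" "\<And>z B n. \<bar>z - supp_minus K\<bar> < r \<Longrightarrow>
      (\<lambda>t. G N (g (z + t))) has_fps_expansion B \<Longrightarrow> \<bar>B $ n\<bar> \<le> c / r ^ n"
    using fps_coeff_bound [of "\<lambda>z. G N (g z)", OF C] by blast
  obtain e where e: "e > 0" "\<And>t. \<bar>t - h_edge\<bar> < e \<Longrightarrow> g (F M N t) = t"
    using g(3) unfolding eventually_nhds_metric by (auto simp: dist_real_def)
  \<comment> \<open>Values of \<open>F M N\<close> between \<open>a\<close> and the lower end point
    come from arguments within \<open>e\<close> of \<open>h_edge\<close>, where \<open>g\<close>
    really inverts \<open>F M N\<close>.\<close>
  define a where "a = F M N (h_edge - e / 2)"
  have a: "a < supp_minus K" unfolding a_def by (rule F_props) (use e in simp)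
  have eq: "G N (g y) = G K y" if y: "a < y" "y < supp_minus K" for y
  proof -
    have GK: "0 < G K y" "ereal (G K y) < G_minus K" using K.G_pos K.G_less_G_minus y by auto
    define h where "h = G_inv N (G K y)"
    have h: "h < supp_minus N" "G N h = G K y"
      using N.G_inv_props [OF GK(1) less_le_trans [OF GK(2) G_minus_K_le(2)]] by (auto simp: h_def)
    then have hh_edge: "h < h_edge" using less_h_edge_iff GK(2) by simp
    have "y \<notin> K.S" using y by auto
    then have Fh: "F M N h = y" using F_eq [OF hh_edge] h(2) by (simp add: K.G_inv_G)
    have "h_edge - e / 2 < h"
    proof (rule ccontr)
      assume "\<not> h_edge - e / 2 < h"
      then have "F M N h \<le> a"
        using F_mono [of h "h_edge - e / 2"] e(1) unfolding a_def by (cases "h = h_edge - e / 2") auto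
      then show False using Fh y(1) by simp
    qed
    then have "g (F M N h) = h" using hh_edge e(1) by (intro e(2)) auto
    then show ?thesis using Fh h(2) by simp
  qed
  \<comment> \<open>The centre \<open>z\<close> is right of \<open>a\<close>, so the continuation
    has there the expansion of \<open>G K\<close>, and within \<open>r\<close> of the end point, so
    the uniform estimate reaches past it.\<close>
  have "max a (supp_minus K - r) < supp_minus K" using a r(1) by simp
  from dense [OF this] obtain z where z: "a < z" "z < supp_minus K" "supp_minus K < z + r" by auto
  have "eventually (\<lambda>y. y \<in> {a<..<supp_minus K}) (nhds z)"
    using z by (intro eventually_nhds_in_open) auto
  then have "eventually (\<lambda>y. G K y = G N (g y)) (nhds z)" by eventually_elim (simp add: eq)
  moreover have "z \<notin> K.S" using z by auto
  ultimately have "(\<lambda>t. G N (g (z + t))) has_fps_expansion cauchy_fps K z"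
    using has_fps_expansion_at_cong [of "G K" "\<lambda>y. G N (g y)" z] K.G_has_fps_expansion by blast
  then have "cauchy_fps K z $ n \<le> c / r ^ n" for n
    using r(2) [of z "cauchy_fps K z" n] z by (simp add: abs_le_iff)
  then show False by (rule K.cauchy_fps_radius_contradiction [OF z(2,3)])
qed

lemma lessThan_h_edge_subset_H_set: "{..<h_edge} \<subseteq> H_set D M N"
proof
  fix h assume h: "h \<in> {..<h_edge}"
  have "\<exists>d>0. (F M N has_real_derivative d) (at t)" if "t < h" for t
  proof -
    have "t < h_edge" using h that by simp
    then show ?thesis using F_derivative_pos by metis
  qed
  then show "h \<in> H_set D M N" using lessThan_h_edge_subset_F_dom h by (auto simp: H_set_def)
qed

text \<open>Membership of a point beyond \<open>h_edge\<close> would demand a positive derivative at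
  \<open>h_edge\<close> itself.\<close>

lemma H_set_le_h_edge:
  assumes "h \<in> H_set D M N"
  shows "h \<le> h_edge"
proof (rule ccontr)
  assume "\<not> h \<le> h_edge"
  then have "h_edge < h" by simp
  then have "h_edge \<in> F_dom D N" using assms F_dom_downward [of h h_edge] by (simp add: H_set_def)
  moreover obtain d where "d > 0" "(F M N has_real_derivative d) (at h_edge)"
    using assms \<open>h_edge < h\<close> by (auto simp: H_set_def)
  ultimately show False using F_derivative_h_edge by blast
qed

lemma H_set_nonempty: "H_set D M N \<noteq> {}"
  using lessThan_h_edge_subset_H_set by auto

lemma h_star_eq: "h_star D M N = h_edge"
  unfolding h_star_def
proof (rule cSup_eq)
  show "h_edge \<le> y" if "\<And>h. h \<in> H_set D M N \<Longrightarrow> h \<le> y" for y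
  proof (rule dense_le)
    fix x assume "x < h_edge"
    then show "x \<le> y" using lessThan_h_edge_subset_H_set by (intro that) auto
  qed
qed (rule H_set_le_h_edge)

lemma supp_minus_eq_SUP: "ereal (supp_minus K) = (SUP h\<in>H_set D M N. ereal (F M N h))"
proof (rule antisym)
  have ev: "eventually (\<lambda>h. h \<in> {h_edge - 1<..<h_edge}) (at_left h_edge)" by (rule eventually_at_left_real) simp
  then have le: "eventually (\<lambda>h. ereal (F M N h) \<le> (SUP h\<in>H_set D M N. ereal (F M N h))) (at_left h_edge)"
  proof eventually_elim
    case (elim h)
    then have "h \<in> H_set D M N" using lessThan_h_edge_subset_H_set by auto
    then show ?case by (rule SUP_upper)
  qed
  have lim: "((\<lambda>h. ereal (F M N h)) \<longlongrightarrow> ereal (supp_minus K)) (at_left h_edge)"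
    using tendsto_F_h_edge by simp
  show "ereal (supp_minus K) \<le> (SUP h\<in>H_set D M N. ereal (F M N h))"
    by (rule tendsto_upperbound [OF lim le]) simp
  show "(SUP h\<in>H_set D M N. ereal (F M N h)) \<le> ereal (supp_minus K)"
  proof (rule SUP_least)
    fix h assume h: "h \<in> H_set D M N"
    then have "h \<in> F_dom D N" by (simp add: H_set_def)
    then show "ereal (F M N h) \<le> ereal (supp_minus K)"
      using H_set_le_h_edge [OF h] F_props(1) [of h] F_h_edge by (cases "h = h_edge") simp_all
  qed
qed

end

text \<open>Below \<open>G_minus K\<close>, hence below \<open>G_minus M\<close>, the values of
  \<open>G N\<close> lie in the negative of \<open>D_hat M\<close> itself, also when
  \<open>D\<close> is larger; the limit passes to the closure in the extended reals.\<close>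

lemma G_minus_K_in_closure: "G_minus K \<in> closure (ereal ` uminus ` D_hat M)"
proof (rule Lim_in_closed_set [OF closed_closure _ _ tendsto_G_h_edge])
  have ev: "eventually (\<lambda>h. h \<in> {h_edge - 1<..<h_edge}) (at_left h_edge)" by (rule eventually_at_left_real) simp
  then show "eventually (\<lambda>h. ereal (G N h) \<in> closure (ereal ` uminus ` D_hat M)) (at_left h_edge)"
  proof eventually_elim
    case (elim h)
    then have "- G N h \<in> D_hat M" using left_of_h_edge by (intro M.minus_in_D_hat) auto
    then have "ereal (G N h) \<in> ereal ` uminus ` D_hat M"
      by (intro imageI rev_image_eqI [of "- G N h"]) simp_all
    then show ?case by (rule subsetD [OF closure_subset])
  qed
qed simp

end

text \<open>Non-emptiness of \<open>H_set\<close> is part of the conclusion so that the real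
  supremum \<open>h_star\<close> is not taken over the empty set. Outside the domain, the value of
  \<open>F\<close> in (d) is expressed as convergence, which includes the existence of the
  limit.\<close>

theorem theorem1p3:
  fixes \<mu> \<nu> \<kappa> :: "real measure"
  assumes "compactly_supported \<mu>" and "compactly_supported \<nu>"
    and "nondegenerate \<mu>"
    and "is_free_convolution \<mu> \<nu> \<kappa>"
  shows "\<forall>D \<in> {R_domain \<mu>, D_hat \<mu>}.
    (\<exists>h_max. F_dom D \<nu> = {..<h_max}) \<and>
    (\<exists>h0. {..<h0} \<subseteq> F_dom D \<nu> \<and> strict_mono_on {..<h0} (F \<mu> \<nu>)) \<and>
    H_set D \<mu> \<nu> \<noteq> {} \<and>
    G_minus \<kappa> = G_left \<nu> (h_star D \<mu> \<nu>) \<and>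
    (h_star D \<mu> \<nu> \<in> F_dom D \<nu> \<longrightarrow> supp_minus \<kappa> = F \<mu> \<nu> (h_star D \<mu> \<nu>)) \<and>
    (h_star D \<mu> \<nu> \<notin> F_dom D \<nu> \<longrightarrow>
       (F \<mu> \<nu> \<longlongrightarrow> supp_minus \<kappa>) (at_left (h_star D \<mu> \<nu>))) \<and>
    ereal (supp_minus \<kappa>) = (SUP h\<in>H_set D \<mu> \<nu>. ereal (F \<mu> \<nu> h)) \<and>
    G_left \<nu> (h_star D \<mu> \<nu>) \<in> closure (ereal ` uminus ` D_hat \<mu>)"
proof -
  have cd: "compact_distribution M" if "compactly_supported M" for M
    using that by (simp add: compactly_supported_def compact_distribution_def compact_distribution_axioms_def)
  have "compactly_supported \<kappa>" using assms(4) by (simp add: is_free_convolution_def)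
  then interpret free_convolution \<mu> \<nu> \<kappa>
    using assms by (intro free_convolution.intro three_distributions.intro free_convolution_axioms.intro cd)
  \<comment> \<open>These four properties are all that was required of \<open>D\<close>, and both
    choices have them; this is claim (f).\<close>
  have *: "D_hat \<mu> \<subseteq> D" "D \<subseteq> R_domain \<mu>" "open D" "is_interval D" if "D \<in> {R_domain \<mu>, D_hat \<mu>}" for D
    using that M.D_hat_subset_R_domain M.open_D_hat M.open_R_domain M.is_interval_D_hat M.is_interval_R_domain
    by auto
  have mono: "strict_mono_on {..<h_edge} (F \<mu> \<nu>)"
    by (rule strict_mono_onI) (simp add: F_mono)
  show ?thesis
  proof (intro ballI, goal_cases)
    case (1 D)
    note D = * [OF 1]
    show ?case
      unfolding h_star_eq [OF D] G_left_h_edge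
      using F_dom_eq_lessThan [OF D] lessThan_h_edge_subset_F_dom [OF D] mono H_set_nonempty [OF D]
        F_h_edge [OF D] tendsto_F_h_edge supp_minus_eq_SUP [OF D] G_minus_K_in_closure
      by (intro conjI impI exI [of "\<lambda>h. {..<h} \<subseteq> F_dom D \<nu> \<and> strict_mono_on {..<h} (F \<mu> \<nu>)" h_edge])
        (assumption | simp)+
  qed
qed

end
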